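(* Let $M,N$ be persistence modules over $\mathbb{R}^n$ and let $\varepsilon\in\mathbb{R}_{\ge 0}$. (a) If $M$ and $N$ are $\varepsilon$-interleaved with respect to $f:M\to N[\varepsilon]$ and $g:N\to M[\varepsilon]$ in $\mathrm{Pers}(\mathbb{R}^n)$, then $P^\bullet(M)$ and $P^\bullet(N)$ are $\varepsilon$-interleaved in $K(\mathrm{Pers}(\mathbb{R}^n))$ with respect to $P^\bullet(f)$ and $P^\bullet(g)$. (b) Conversely, if $P^\bullet(M)$ and $P^\bullet(N)$ are $\varepsilon$-interleaved in $K(\mathrm{Pers}(\mathbb{R}^n))$ with respect to $\varphi:P^\bullet(M)\to P^\bullet(N)[\varepsilon]$ and $\psi:P^\bullet(N)\to P^\bullet(M)[\varepsilon]$, then $M$ and $N$ are $\varepsilon$-interleaved in $\mathrm{Pers}(\mathbb{R}^n)$ with respect to $\mathrm{H}^0(\varphi)$ and $\mathrm{H}^0(\psi)$.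
   Context: Fix a field $\mathbf{k}$ and an integer $n>0$; $\mathbb{R}^n$ carries the product partial order, viewed as a poset category. A persistence module over $\mathbb{R}^n$ is a functor $(\mathbb{R}^n,\le)\to\mathrm{Mod}(\mathbf{k})$ (the category of $\mathbf{k}$-vector spaces); with natural transformations these form the abelian category $\mathrm{Pers}(\mathbb{R}^n)$, which has enough projectives. Shift and smoothing. For $\varepsilon\in\mathbb{R}$, $M[\varepsilon]$ is defined by $M[\varepsilon](s)=M(s+(\varepsilon,\dots,\varepsilon))$ and $M[\varepsilon](s\le t)=M(s+(\varepsilon,\dots,\varepsilon)\le t+(\varepsilon,\dots,\varepsilon))$; this is an endofunctor. For $\varepsilon\ge 0$, $s_\varepsilon^M:M\to M[\varepsilon]$ is the morphism with components $M(t\le t+(\varepsilon,\dots,\varepsilon))$. Interleavings of modules. For $\varepsilon\ge0$, $M,N$ are $\varepsilon$-interleaved with respect to $f:M\to N[\varepsilon]$, $g:N\to M[\varepsilon]$ if $g[\varepsilon]\circ f=s_{2\varepsilon}^M$ and $f[\varepsilon]\circ g=s_{2\varepsilon}^N$. Homotopy category. $K(\mathrm{Pers}(\mathbb{R}^n))$ has as objects cochain complexes of persistence modules and as morphisms chain maps modulo chain homotopy. For a complex $X$, $X[\varepsilon]$ denotes the functor $[\varepsilon]$ applied degreewise (NOT the homological degree shift); this induces an endofunctor of $K(\mathrm{Pers}(\mathbb{R}^n))$. $[s_\varepsilon^X]$ is the homotopy class of the chain map $X\to X[\varepsilon]$ equal to $s_\varepsilon^{X^i}$ in degree $i$. Complexes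 $X,Y$ are $\varepsilon$-interleaved in $K(\mathrm{Pers}(\mathbb{R}^n))$ with respect to morphisms $f:X\to Y[\varepsilon]$, $g:Y\to X[\varepsilon]$ of $K(\mathrm{Pers}(\mathbb{R}^n))$ if $g[\varepsilon]\circ f=[s_{2\varepsilon}^X]$ and $f[\varepsilon]\circ g=[s_{2\varepsilon}^Y]$ in $K(\mathrm{Pers}(\mathbb{R}^n))$. Resolution functor. $P^\bullet:\mathrm{Pers}(\mathbb{R}^n)\to K(\mathrm{Pers}(\mathbb{R}^n))$ is a fixed resolution functor: for each $M$ a projective resolution $P^\bullet(M)$ is chosen (a complex of projectives in degrees $\le 0$, with $\mathrm{H}^j=0$ for $j\ne0$, and with an identification $\mathrm{H}^0(P^\bullet(M))\simeq M$), and a morphism $f$ is sent to the homotopy class of any chain map lifting $f$ (inducing $f$ on $\mathrm{H}^0$). Identifications. $P^\bullet(M)[\varepsilon]$ is a projective resolution of $M[\varepsilon]$, and $P^\bullet(M[\varepsilon])$ is identified with $P^\bullet(M)[\varepsilon]$ in $K(\mathrm{Pers}(\mathbb{R}^n))$ through the isomorphism lifting $\mathrm{id}_{M[\varepsilon]}$. Thus $P^\bullet(f)$ for $f:M\to N[\varepsilon]$ is regarded as a morphism $P^\bullet(M)\to P^\bullet(N)[\varepsilon]$, and $\mathrm{H}^0(\varphi)$ for $\varphi:P^\bullet(M)\to P^\bullet(N)[\varepsilon]$ as a morphism $M\to N[\varepsilon]$. *)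

theory Defs
  imports "HOL-Analysis.Finite_Cartesian_Product" "HOL-Algebra.AbelCoset" "HOL-Algebra.Module"
begin

text \<open>
  The field is a HOL-Algebra field \<open>K\<close>, and a vector space over it is a HOL-Algebra module record
  whose carrier is an arbitrary subset of a type \<open>'v\<close>.  The type \<open>'v\<close> plays the role of the
  universe: objects of \<open>Pers(\<real>\<^sup>n)\<close> are the persistence modules with values in such spaces, and
  projectivity is meant in this category.  The poset is \<open>real ^ 'n\<close> with the componentwise order of
  the library, and \<open>vec \<epsilon>\<close> is the constant vector \<open>(\<epsilon>,\<dots>,\<epsilon>)\<close>.

  Morphisms are families of HOL functions whose values outside the carriers are irrelevant, so they
  are compared on the carriers only; likewise \<open>tr M s t\<close> is only meaningful if \<open>s \<le> t\<close>.
\<close>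

section \<open>Persistence modules\<close>

definition lin_map ::
  "'k ring \<Rightarrow> ('k, 'v) module \<Rightarrow> ('k, 'w) module \<Rightarrow> ('v \<Rightarrow> 'w) \<Rightarrow> bool" where
  "lin_map K V W f \<longleftrightarrow> f \<in> hom (add_monoid V) (add_monoid W) \<and>
     (\<forall>a\<in>carrier K. \<forall>x\<in>carrier V. f (a \<odot>\<^bsub>V\<^esub> x) = a \<odot>\<^bsub>W\<^esub> f x)"

record ('n::finite, 'k, 'v) pmod =
  obj :: "real ^ 'n \<Rightarrow> ('k, 'v) module"
  tr :: "real ^ 'n \<Rightarrow> real ^ 'n \<Rightarrow> 'v \<Rightarrow> 'v"

type_synonym ('n, 'v, 'w) pmor = "real ^ 'n \<Rightarrow> 'v \<Rightarrow> 'w"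

definition persistence_module :: "'k ring \<Rightarrow> ('n::finite, 'k, 'v) pmod \<Rightarrow> bool" where
  "persistence_module K M \<longleftrightarrow>
     (\<forall>s. Module.module K (obj M s)) \<and>
     (\<forall>s t. s \<le> t \<longrightarrow> lin_map K (obj M s) (obj M t) (tr M s t)) \<and>
     (\<forall>s. \<forall>x\<in>carrier (obj M s). tr M s s x = x) \<and>
     (\<forall>s t u. s \<le> t \<longrightarrow> t \<le> u \<longrightarrow>
        (\<forall>x\<in>carrier (obj M s). tr M t u (tr M s t x) = tr M s u x))"

definition pers_hom ::
  "'k ring \<Rightarrow> ('n::finite, 'k, 'v) pmod \<Rightarrow> ('n, 'k, 'w) pmod \<Rightarrow> ('n, 'v, 'w) pmor \<Rightarrow> bool" where
  "pers_hom K M N f \<longleftrightarrow>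
     (\<forall>s. lin_map K (obj M s) (obj N s) (f s)) \<and>
     (\<forall>s t. s \<le> t \<longrightarrow> (\<forall>x\<in>carrier (obj M s). f t (tr M s t x) = tr N s t (f s x)))"

definition pers_eq ::
  "('n::finite, 'k, 'v) pmod \<Rightarrow> ('n, 'v, 'w) pmor \<Rightarrow> ('n, 'v, 'w) pmor \<Rightarrow> bool" where
  "pers_eq M f g \<longleftrightarrow> (\<forall>s. \<forall>x\<in>carrier (obj M s). f s x = g s x)"

definition pers_id :: "('n::finite, 'v, 'v) pmor" where
  "pers_id = (\<lambda>s x. x)"

definition pers_comp ::
  "('n::finite, 'v, 'w) pmor \<Rightarrow> ('n, 'u, 'v) pmor \<Rightarrow> ('n, 'u, 'w) pmor" where
  "pers_comp g f = (\<lambda>s. g s \<circ> f s)"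

definition pers_iso ::
  "'k ring \<Rightarrow> ('n::finite, 'k, 'v) pmod \<Rightarrow> ('n, 'k, 'w) pmod \<Rightarrow> ('n, 'v, 'w) pmor \<Rightarrow> bool" where
  "pers_iso K M N f \<longleftrightarrow> pers_hom K M N f \<and>
     (\<exists>g. pers_hom K N M g \<and> pers_eq M (pers_comp g f) pers_id \<and> pers_eq N (pers_comp f g) pers_id)"

definition pers_epi ::
  "'k ring \<Rightarrow> ('n::finite, 'k, 'v) pmod \<Rightarrow> ('n, 'k, 'v) pmod \<Rightarrow> ('n, 'v, 'v) pmor \<Rightarrow> bool" where
  "pers_epi K A B e \<longleftrightarrow> pers_hom K A B e \<and>
     (\<forall>(C :: ('n, 'k, 'v) pmod) g h.
        persistence_module K C \<longrightarrow> pers_hom K B C g \<longrightarrow> pers_hom K B C h \<longrightarrow>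
        pers_eq A (pers_comp g e) (pers_comp h e) \<longrightarrow> pers_eq B g h)"

definition pers_projective :: "'k ring \<Rightarrow> ('n::finite, 'k, 'v) pmod \<Rightarrow> bool" where
  "pers_projective K Q \<longleftrightarrow> persistence_module K Q \<and>
     (\<forall>(A :: ('n, 'k, 'v) pmod) (B :: ('n, 'k, 'v) pmod) e f.
        persistence_module K A \<longrightarrow> persistence_module K B \<longrightarrow> pers_epi K A B e \<longrightarrow>
        pers_hom K Q B f \<longrightarrow> (\<exists>g. pers_hom K Q A g \<and> pers_eq Q (pers_comp e g) f))"

definition pers_zero :: "('n::finite, 'k, 'v) pmod \<Rightarrow> bool" where
  "pers_zero M \<longleftrightarrow> (\<forall>s. carrier (obj M s) = {\<zero>\<^bsub>obj M s\<^esub>})"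


section \<open>Shift, smoothing and interleavings of modules\<close>

definition pshift :: "real \<Rightarrow> ('n::finite, 'k, 'v) pmod \<Rightarrow> ('n, 'k, 'v) pmod" where
  "pshift \<epsilon> M = \<lparr>obj = (\<lambda>s. obj M (s + vec \<epsilon>)), tr = (\<lambda>s t. tr M (s + vec \<epsilon>) (t + vec \<epsilon>))\<rparr>"

definition mor_shift :: "real \<Rightarrow> ('n::finite, 'v, 'w) pmor \<Rightarrow> ('n, 'v, 'w) pmor" where
  "mor_shift \<epsilon> f = (\<lambda>s. f (s + vec \<epsilon>))"

definition smoothing :: "real \<Rightarrow> ('n::finite, 'k, 'v) pmod \<Rightarrow> ('n, 'v, 'v) pmor" where
  "smoothing \<epsilon> M = (\<lambda>t. tr M t (t + vec \<epsilon>))"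

definition pers_interleaved ::
  "'k ring \<Rightarrow> real \<Rightarrow> ('n::finite, 'k, 'v) pmod \<Rightarrow> ('n, 'k, 'v) pmod \<Rightarrow>
     ('n, 'v, 'v) pmor \<Rightarrow> ('n, 'v, 'v) pmor \<Rightarrow> bool" where
  "pers_interleaved K \<epsilon> M N f g \<longleftrightarrow>
     pers_hom K M (pshift \<epsilon> N) f \<and> pers_hom K N (pshift \<epsilon> M) g \<and>
     pers_eq M (pers_comp (mor_shift \<epsilon> g) f) (smoothing (2 * \<epsilon>) M) \<and>
     pers_eq N (pers_comp (mor_shift \<epsilon> f) g) (smoothing (2 * \<epsilon>) N)"

text \<open>Both sides of the interleaving equations are morphisms to \<open>M[2\<epsilon>]\<close>, because:\<close>

lemma pshift_pshift: "pshift \<delta> (pshift \<epsilon> M) = pshift (\<delta> + \<epsilon>) M"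
proof -
  have "vec \<delta> + vec \<epsilon> = (vec (\<delta> + \<epsilon>) :: real ^ 'a)"
    by (simp add: vec_eq_iff vec_def)
  then show ?thesis
    by (simp add: pshift_def add.assoc)
qed


section \<open>Cochain complexes and the homotopy category\<close>

record ('n::finite, 'k, 'v) pcomplex =
  cobj :: "int \<Rightarrow> ('n, 'k, 'v) pmod"
  cdiff :: "int \<Rightarrow> ('n, 'v, 'v) pmor"

type_synonym ('n, 'v) cmor = "int \<Rightarrow> ('n, 'v, 'v) pmor"

definition cochain_complex :: "'k ring \<Rightarrow> ('n::finite, 'k, 'v) pcomplex \<Rightarrow> bool" where
  "cochain_complex K X \<longleftrightarrow>
     (\<forall>i. persistence_module K (cobj X i)) \<and>
     (\<forall>i. pers_hom K (cobj X i) (cobj X (i + 1)) (cdiff X i)) \<and>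
     (\<forall>i s. \<forall>x\<in>carrier (obj (cobj X i) s).
        cdiff X (i + 1) s (cdiff X i s x) = \<zero>\<^bsub>obj (cobj X (i + 2)) s\<^esub>)"

definition chain_map ::
  "'k ring \<Rightarrow> ('n::finite, 'k, 'v) pcomplex \<Rightarrow> ('n, 'k, 'v) pcomplex \<Rightarrow> ('n, 'v) cmor \<Rightarrow> bool" where
  "chain_map K X Y f \<longleftrightarrow>
     (\<forall>i. pers_hom K (cobj X i) (cobj Y i) (f i)) \<and>
     (\<forall>i. pers_eq (cobj X i) (pers_comp (f (i + 1)) (cdiff X i)) (pers_comp (cdiff Y i) (f i)))"

definition chain_homotopic ::
  "'k ring \<Rightarrow> ('n::finite, 'k, 'v) pcomplex \<Rightarrow> ('n, 'k, 'v) pcomplex \<Rightarrow>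
     ('n, 'v) cmor \<Rightarrow> ('n, 'v) cmor \<Rightarrow> bool" where
  "chain_homotopic K X Y f g \<longleftrightarrow>
     (\<exists>h. (\<forall>i. pers_hom K (cobj X i) (cobj Y (i - 1)) (h i)) \<and>
          (\<forall>i s. \<forall>x\<in>carrier (obj (cobj X i) s).
             f i s x \<ominus>\<^bsub>obj (cobj Y i) s\<^esub> g i s x =
             cdiff Y (i - 1) s (h i s x) \<oplus>\<^bsub>obj (cobj Y i) s\<^esub> h (i + 1) s (cdiff X i s x)))"

definition homotopy_rel ::
  "'k ring \<Rightarrow> ('n::finite, 'k, 'v) pcomplex \<Rightarrow> ('n, 'k, 'v) pcomplex \<Rightarrow>
     (('n, 'v) cmor \<times> ('n, 'v) cmor) set" where
  "homotopy_rel K X Y =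
     {(f, g). chain_map K X Y f \<and> chain_map K X Y g \<and> chain_homotopic K X Y f g}"

definition hclass ::
  "'k ring \<Rightarrow> ('n::finite, 'k, 'v) pcomplex \<Rightarrow> ('n, 'k, 'v) pcomplex \<Rightarrow>
     ('n, 'v) cmor \<Rightarrow> ('n, 'v) cmor set" where
  "hclass K X Y f = homotopy_rel K X Y `` {f}"

definition K_hom ::
  "'k ring \<Rightarrow> ('n::finite, 'k, 'v) pcomplex \<Rightarrow> ('n, 'k, 'v) pcomplex \<Rightarrow> ('n, 'v) cmor set set" where
  "K_hom K X Y = {f. chain_map K X Y f} // homotopy_rel K X Y"

text \<open>The composite of \<open>F : X \<rightarrow> Y\<close> and \<open>G : Y \<rightarrow> Z\<close>, and the functor \<open>[\<epsilon>]\<close> on \<open>F : X \<rightarrow> Y\<close>: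
  the union over all representatives is the class of any one of them.\<close>

definition K_comp ::
  "'k ring \<Rightarrow> ('n::finite, 'k, 'v) pcomplex \<Rightarrow> ('n, 'k, 'v) pcomplex \<Rightarrow>
     ('n, 'v) cmor set \<Rightarrow> ('n, 'v) cmor set \<Rightarrow> ('n, 'v) cmor set" where
  "K_comp K X Z G F = (\<Union>g\<in>G. \<Union>f\<in>F. hclass K X Z (\<lambda>i. pers_comp (g i) (f i)))"

definition cshift :: "real \<Rightarrow> ('n::finite, 'k, 'v) pcomplex \<Rightarrow> ('n, 'k, 'v) pcomplex" where
  "cshift \<epsilon> X = \<lparr>cobj = (\<lambda>i. pshift \<epsilon> (cobj X i)), cdiff = (\<lambda>i. mor_shift \<epsilon> (cdiff X i))\<rparr>"

definition K_shift ::
  "'k ring \<Rightarrow> real \<Rightarrow> ('n::finite, 'k, 'v) pcomplex \<Rightarrow> ('n, 'k, 'v) pcomplex \<Rightarrow>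
     ('n, 'v) cmor set \<Rightarrow> ('n, 'v) cmor set" where
  "K_shift K \<epsilon> X Y F =
     (\<Union>f\<in>F. hclass K (cshift \<epsilon> X) (cshift \<epsilon> Y) (\<lambda>i. mor_shift \<epsilon> (f i)))"

definition K_smoothing ::
  "'k ring \<Rightarrow> real \<Rightarrow> ('n::finite, 'k, 'v) pcomplex \<Rightarrow> ('n, 'v) cmor set" where
  "K_smoothing K \<epsilon> X = hclass K X (cshift \<epsilon> X) (\<lambda>i. smoothing \<epsilon> (cobj X i))"

definition K_interleaved ::
  "'k ring \<Rightarrow> real \<Rightarrow> ('n::finite, 'k, 'v) pcomplex \<Rightarrow> ('n, 'k, 'v) pcomplex \<Rightarrow>
     ('n, 'v) cmor set \<Rightarrow> ('n, 'v) cmor set \<Rightarrow> bool" where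
  "K_interleaved K \<epsilon> X Y F G \<longleftrightarrow>
     F \<in> K_hom K X (cshift \<epsilon> Y) \<and> G \<in> K_hom K Y (cshift \<epsilon> X) \<and>
     K_comp K X (cshift \<epsilon> (cshift \<epsilon> X)) (K_shift K \<epsilon> Y (cshift \<epsilon> X) G) F = K_smoothing K (2 * \<epsilon>) X \<and>
     K_comp K Y (cshift \<epsilon> (cshift \<epsilon> Y)) (K_shift K \<epsilon> X (cshift \<epsilon> Y) F) G = K_smoothing K (2 * \<epsilon>) Y"

lemma cshift_cshift: "cshift \<delta> (cshift \<epsilon> X) = cshift (\<delta> + \<epsilon>) X"
proof -
  have "vec \<delta> + vec \<epsilon> = (vec (\<delta> + \<epsilon>) :: real ^ 'a)"
    by (simp add: vec_eq_iff vec_def)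
  then show ?thesis
    by (simp add: cshift_def pshift_pshift mor_shift_def add.assoc)
qed


section \<open>Cohomology\<close>

definition cocycles ::
  "('n::finite, 'k, 'v) pcomplex \<Rightarrow> int \<Rightarrow> real ^ 'n \<Rightarrow> 'v set" where
  "cocycles X j s = a_kernel (obj (cobj X j) s) (obj (cobj X (j + 1)) s) (cdiff X j s)"

definition coboundaries ::
  "('n::finite, 'k, 'v) pcomplex \<Rightarrow> int \<Rightarrow> real ^ 'n \<Rightarrow> 'v set" where
  "coboundaries X j s = cdiff X (j - 1) s ` carrier (obj (cobj X (j - 1)) s)"

text \<open>The map sending the coset of \<open>x\<close> to the coset \<open>B + f x\<close> in \<open>W\<close>; the union over the elements
  of a coset is the common value at all of them when \<open>f\<close> descends to the quotients.\<close>

definition coset_map ::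
  "('k, 'w) module \<Rightarrow> 'w set \<Rightarrow> ('v \<Rightarrow> 'w) \<Rightarrow> 'v set \<Rightarrow> 'w set" where
  "coset_map W B f c = (\<Union>x\<in>c. B +>\<^bsub>W\<^esub> f x)"

text \<open>The ring multiplication and unit of the record are not part of the module structure.\<close>

definition cohomology ::
  "('n::finite, 'k, 'v) pcomplex \<Rightarrow> int \<Rightarrow> ('n, 'k, 'v set) pmod" where
  "cohomology X j =
     \<lparr>obj = (\<lambda>s. let V = obj (cobj X j) s; B = coboundaries X j s in
         \<lparr>carrier = a_rcosets\<^bsub>V\<lparr>carrier := cocycles X j s\<rparr>\<^esub> B,
          mult = undefined, one = undefined,
          zero = B,
          add = set_add V,
          smult = (\<lambda>a. coset_map V B (\<lambda>x. a \<odot>\<^bsub>V\<^esub> x))\<rparr>),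
      tr = (\<lambda>s t. coset_map (obj (cobj X j) t) (coboundaries X j t) (tr (cobj X j) s t))\<rparr>"

definition cohomology_map ::
  "('n::finite, 'k, 'v) pcomplex \<Rightarrow> int \<Rightarrow> ('n, 'v) cmor \<Rightarrow> ('n, 'v set, 'v set) pmor" where
  "cohomology_map Y j f = (\<lambda>s. coset_map (obj (cobj Y j) s) (coboundaries Y j s) (f j s))"


section \<open>Resolutions\<close>

text \<open>A resolution of \<open>M\<close> comes with an identification \<open>\<alpha>\<close> of its cohomology in degree \<open>0\<close>
  with \<open>M\<close>.\<close>

definition projective_resolution ::
  "'k ring \<Rightarrow> ('n::finite, 'k, 'v) pmod \<Rightarrow> ('n, 'k, 'v) pcomplex \<Rightarrow> ('n, 'v set, 'v) pmor \<Rightarrow> bool" where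
  "projective_resolution K M X \<alpha> \<longleftrightarrow>
     cochain_complex K X \<and>
     (\<forall>i. pers_projective K (cobj X i)) \<and>
     (\<forall>i>0. pers_zero (cobj X i)) \<and>
     (\<forall>j. j \<noteq> 0 \<longrightarrow> pers_zero (cohomology X j)) \<and>
     pers_iso K (cohomology X 0) M \<alpha>"

text \<open>For \<open>X\<close>, \<open>Y\<close> with identifications \<open>\<alpha>\<close>, \<open>\<beta>\<close> of their degree \<open>0\<close> cohomology with \<open>M\<close>, \<open>N\<close>:
  the chain map \<open>\<phi> : X \<rightarrow> Y\<close> induces \<open>f : M \<rightarrow> N\<close>, and the homotopy class of a chosen such \<open>\<phi>\<close>.\<close>

definition lifts ::
  "('n::finite, 'k, 'v) pcomplex \<Rightarrow> ('n, 'v set, 'v) pmor \<Rightarrow>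
   ('n, 'k, 'v) pcomplex \<Rightarrow> ('n, 'v set, 'v) pmor \<Rightarrow> ('n, 'v, 'v) pmor \<Rightarrow> ('n, 'v) cmor \<Rightarrow> bool" where
  "lifts X \<alpha> Y \<beta> f \<phi> \<longleftrightarrow>
     pers_eq (cohomology X 0) (pers_comp \<beta> (cohomology_map Y 0 \<phi>)) (pers_comp f \<alpha>)"

definition lift_class ::
  "'k ring \<Rightarrow> ('n::finite, 'k, 'v) pcomplex \<Rightarrow> ('n, 'v set, 'v) pmor \<Rightarrow>
   ('n, 'k, 'v) pcomplex \<Rightarrow> ('n, 'v set, 'v) pmor \<Rightarrow> ('n, 'v, 'v) pmor \<Rightarrow> ('n, 'v) cmor set" where
  "lift_class K X \<alpha> Y \<beta> f = hclass K X Y (SOME \<phi>. chain_map K X Y \<phi> \<and> lifts X \<alpha> Y \<beta> f \<phi>)"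

text \<open>A resolution functor is given by \<open>P\<close> and \<open>\<alpha>\<close>, choosing for every \<open>M\<close> a resolution \<open>P M\<close>
  with identification \<open>\<alpha> M\<close>; this choice determines its values on morphisms.\<close>

definition resolution_functor ::
  "'k ring \<Rightarrow> (('n::finite, 'k, 'v) pmod \<Rightarrow> ('n, 'k, 'v) pcomplex) \<Rightarrow>
     (('n, 'k, 'v) pmod \<Rightarrow> ('n, 'v set, 'v) pmor) \<Rightarrow> bool" where
  "resolution_functor K P \<alpha> \<longleftrightarrow>
     (\<forall>M. persistence_module K M \<longrightarrow> projective_resolution K M (P M) (\<alpha> M))"

definition res_mor ::
  "'k ring \<Rightarrow> (('n::finite, 'k, 'v) pmod \<Rightarrow> ('n, 'k, 'v) pcomplex) \<Rightarrow>
     (('n, 'k, 'v) pmod \<Rightarrow> ('n, 'v set, 'v) pmor) \<Rightarrow>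
     ('n, 'k, 'v) pmod \<Rightarrow> ('n, 'k, 'v) pmod \<Rightarrow> ('n, 'v, 'v) pmor \<Rightarrow> ('n, 'v) cmor set" where
  "res_mor K P \<alpha> M N f = lift_class K (P M) (\<alpha> M) (P N) (\<alpha> N) f"

text \<open>The identification \<open>P(M[\<epsilon>]) \<rightarrow> P(M)[\<epsilon>]\<close> lifting the identity of \<open>M[\<epsilon>]\<close>.  The cohomology of
  \<open>P(M)[\<epsilon>]\<close> is the shifted cohomology of \<open>P(M)\<close>, hence identified with \<open>M[\<epsilon>]\<close> by the shift of
  \<open>\<alpha> M\<close>.\<close>

definition res_shift_ident ::
  "'k ring \<Rightarrow> (('n::finite, 'k, 'v) pmod \<Rightarrow> ('n, 'k, 'v) pcomplex) \<Rightarrow>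
     (('n, 'k, 'v) pmod \<Rightarrow> ('n, 'v set, 'v) pmor) \<Rightarrow>
     real \<Rightarrow> ('n, 'k, 'v) pmod \<Rightarrow> ('n, 'v) cmor set" where
  "res_shift_ident K P \<alpha> \<epsilon> M =
     lift_class K (P (pshift \<epsilon> M)) (\<alpha> (pshift \<epsilon> M)) (cshift \<epsilon> (P M)) (mor_shift \<epsilon> (\<alpha> M)) pers_id"

text \<open>For \<open>f : M \<rightarrow> N[\<epsilon>]\<close>, the morphism \<open>P(f)\<close> regarded as \<open>P(M) \<rightarrow> P(N)[\<epsilon>]\<close>.\<close>

definition res_mor_shift ::
  "'k ring \<Rightarrow> (('n::finite, 'k, 'v) pmod \<Rightarrow> ('n, 'k, 'v) pcomplex) \<Rightarrow>
     (('n, 'k, 'v) pmod \<Rightarrow> ('n, 'v set, 'v) pmor) \<Rightarrow>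
     real \<Rightarrow> ('n, 'k, 'v) pmod \<Rightarrow> ('n, 'k, 'v) pmod \<Rightarrow> ('n, 'v, 'v) pmor \<Rightarrow> ('n, 'v) cmor set" where
  "res_mor_shift K P \<alpha> \<epsilon> M N f =
     K_comp K (P M) (cshift \<epsilon> (P N)) (res_shift_ident K P \<alpha> \<epsilon> N) (res_mor K P \<alpha> M (pshift \<epsilon> N) f)"

text \<open>For a homotopy class \<open>F : P(M) \<rightarrow> P(N)[\<epsilon>]\<close>, the morphism
  \<open>M \<cong> H\<^sup>0(P(M)) \<rightarrow> H\<^sup>0(P(N)[\<epsilon>]) \<cong> N[\<epsilon>]\<close> induced by any representative.\<close>

definition H0_mor_shift ::
  "(('n::finite, 'k, 'v) pmod \<Rightarrow> ('n, 'k, 'v) pcomplex) \<Rightarrow>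
     (('n, 'k, 'v) pmod \<Rightarrow> ('n, 'v set, 'v) pmor) \<Rightarrow>
     real \<Rightarrow> ('n, 'k, 'v) pmod \<Rightarrow> ('n, 'k, 'v) pmod \<Rightarrow> ('n, 'v) cmor set \<Rightarrow> ('n, 'v, 'v) pmor" where
  "H0_mor_shift P \<alpha> \<epsilon> M N F =
     pers_comp (mor_shift \<epsilon> (\<alpha> N))
       (pers_comp (cohomology_map (cshift \<epsilon> (P N)) 0 (SOME \<phi>. \<phi> \<in> F))
         (\<lambda>s. inv_into (carrier (obj (cohomology (P M) 0) s)) (\<alpha> M s)))"

end

theory Submission
  imports Defs
begin

text \<open>
  A resolution of \<open>M\<close> is an exact sequence ending in an augmentation \<open>X\<^sup>0 \<rightarrow> M\<close>, and a chain map
  between resolutions of \<open>M\<close> and \<open>N\<close> covers exactly one morphism \<open>M \<rightarrow> N\<close>.  By the comparison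
  theorem every morphism is covered, and two chain maps are homotopic iff they cover the same
  morphism.  So the morphisms in the homotopy category between resolutions are exactly the sets
  \<open>covering \<dots> f\<close>, one for each \<open>f : M \<rightarrow> N\<close>.  Composition, shift and smoothing act on these sets
  through \<open>f\<close>, and both the value of the resolution functor at \<open>f\<close> and the inverse of \<open>H\<^sup>0\<close> are
  \<open>f \<mapsto> covering \<dots> f\<close>.  Hence the two notions of interleaving correspond.
\<close>

section \<open>Linear maps\<close>

lemma lin_map_closed:
  "lin_map K V W f \<Longrightarrow> x \<in> carrier V \<Longrightarrow> f x \<in> carrier W"
  by (auto simp: lin_map_def hom_def)

lemma lin_map_add:
  "lin_map K V W f \<Longrightarrow> x \<in> carrier V \<Longrightarrow> y \<in> carrier V \<Longrightarrow> f (x \<oplus>\<^bsub>V\<^esub> y) = f x \<oplus>\<^bsub>W\<^esub> f y"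
  by (auto simp: lin_map_def hom_def)

lemma lin_map_smult:
  "lin_map K V W f \<Longrightarrow> a \<in> carrier K \<Longrightarrow> x \<in> carrier V \<Longrightarrow> f (a \<odot>\<^bsub>V\<^esub> x) = a \<odot>\<^bsub>W\<^esub> f x"
  by (auto simp: lin_map_def)

lemma lin_mapI:
  assumes "\<And>x. x \<in> carrier V \<Longrightarrow> f x \<in> carrier W"
    and "\<And>x y. x \<in> carrier V \<Longrightarrow> y \<in> carrier V \<Longrightarrow> f (x \<oplus>\<^bsub>V\<^esub> y) = f x \<oplus>\<^bsub>W\<^esub> f y"
    and "\<And>a x. a \<in> carrier K \<Longrightarrow> x \<in> carrier V \<Longrightarrow> f (a \<odot>\<^bsub>V\<^esub> x) = a \<odot>\<^bsub>W\<^esub> f x"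
  shows "lin_map K V W f"
  using assms by (auto simp: lin_map_def hom_def)

lemma lin_map_abelian_group_hom:
  assumes "Module.module K V" "Module.module K W" "lin_map K V W f"
  shows "abelian_group_hom V W f"
proof -
  interpret V: module K V by fact
  interpret W: module K W by fact
  show ?thesis
    using assms(3) V.a_group W.a_group
    by (intro abelian_group_homI V.abelian_group_axioms W.abelian_group_axioms)
      (simp add: group_hom_def group_hom_axioms_def lin_map_def)
qed

lemma lin_map_zero:
  assumes "Module.module K V" "Module.module K W" "lin_map K V W f"
  shows "f \<zero>\<^bsub>V\<^esub> = \<zero>\<^bsub>W\<^esub>"
  using abelian_group_hom.hom_zero[OF lin_map_abelian_group_hom[OF assms]] .

lemma lin_map_uminus:
  assumes "Module.module K V" "Module.module K W" "lin_map K V W f" "x \<in> carrier V"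
  shows "f (\<ominus>\<^bsub>V\<^esub> x) = \<ominus>\<^bsub>W\<^esub> f x"
  using abelian_group_hom.hom_a_inv[OF lin_map_abelian_group_hom[OF assms(1-3)] assms(4)] .

lemma lin_map_minus:
  assumes "Module.module K V" "Module.module K W" "lin_map K V W f" "x \<in> carrier V" "y \<in> carrier V"
  shows "f (x \<ominus>\<^bsub>V\<^esub> y) = f x \<ominus>\<^bsub>W\<^esub> f y"
proof -
  interpret V: module K V by fact
  interpret W: module K W by fact
  show ?thesis
    using assms by (simp add: V.minus_eq W.minus_eq lin_map_add[OF assms(3)] lin_map_uminus)
qed

lemma lin_map_comp:
  "lin_map K U V f \<Longrightarrow> lin_map K V W g \<Longrightarrow> lin_map K U W (g \<circ> f)"
  by (rule lin_mapI) (simp_all add: lin_map_closed lin_map_add lin_map_smult)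

lemma lin_map_diff:
  assumes "Module.module K W" "lin_map K V W f" "lin_map K V W g"
  shows "lin_map K V W (\<lambda>x. f x \<ominus>\<^bsub>W\<^esub> g x)"
proof -
  interpret W: module K W by fact
  note cl = lin_map_closed[OF assms(2)] lin_map_closed[OF assms(3)]
  note [simp] = lin_map_add[OF assms(2)] lin_map_add[OF assms(3)]
    lin_map_smult[OF assms(2)] lin_map_smult[OF assms(3)]
  show ?thesis
    by (rule lin_mapI)
      (auto simp: W.minus_eq cl W.minus_add W.smult_r_distr W.smult_r_minus W.a_ac)
qed

lemma lin_map_const_zero: "Module.module K W \<Longrightarrow> lin_map K V W (\<lambda>x. \<zero>\<^bsub>W\<^esub>)"
proof -
  assume "Module.module K W"
  then interpret W: module K W .
  show ?thesis by (rule lin_mapI) auto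
qed

text \<open>Serves two purposes: images of morphisms become objects to lift against, and
  coboundaries become submodules to divide by.\<close>

lemma submodule_image:
  assumes "Module.module K V" "Module.module K W" "lin_map K V W f"
  shows "submodule (f ` carrier V) K W"
proof -
  interpret V: module K V by fact
  interpret W: module K W by fact
  note [simp] = lin_map_add[OF assms(3), symmetric] lin_map_smult[OF assms(3), symmetric]
    lin_map_uminus[OF assms, symmetric]
  show ?thesis
  proof (rule W.submoduleI)
    show "f ` carrier V \<subseteq> carrier W"
      using lin_map_closed[OF assms(3)] by auto
    show "\<zero>\<^bsub>W\<^esub> \<in> f ` carrier V"
      using lin_map_zero[OF assms] V.zero_closed by (metis imageI)
  qed auto
qed


section \<open>Morphisms of persistence modules\<close>

lemma pers_module: "persistence_module K M \<Longrightarrow> Module.module K (obj M s)"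
  by (simp add: persistence_module_def)

lemma pers_hom_lin: "pers_hom K M N f \<Longrightarrow> lin_map K (obj M s) (obj N s) (f s)"
  by (simp add: pers_hom_def)

lemma pers_hom_closed:
  "pers_hom K M N f \<Longrightarrow> x \<in> carrier (obj M s) \<Longrightarrow> f s x \<in> carrier (obj N s)"
  by (rule lin_map_closed[OF pers_hom_lin])

lemma pers_hom_nat:
  "pers_hom K M N f \<Longrightarrow> s \<le> t \<Longrightarrow> x \<in> carrier (obj M s) \<Longrightarrow> f t (tr M s t x) = tr N s t (f s x)"
  by (simp add: pers_hom_def)

lemma tr_lin: "persistence_module K M \<Longrightarrow> s \<le> t \<Longrightarrow> lin_map K (obj M s) (obj M t) (tr M s t)"
  by (simp add: persistence_module_def)

lemma pers_hom_zero:
  assumes "persistence_module K M" "persistence_module K N" "pers_hom K M N f"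
  shows "f s \<zero>\<^bsub>obj M s\<^esub> = \<zero>\<^bsub>obj N s\<^esub>"
  using lin_map_zero[OF pers_module[OF assms(1)] pers_module[OF assms(2)] pers_hom_lin[OF assms(3)]] .

lemma pers_hom_minus:
  assumes "persistence_module K M" "persistence_module K N" "pers_hom K M N f"
    "x \<in> carrier (obj M s)" "y \<in> carrier (obj M s)"
  shows "f s (x \<ominus>\<^bsub>obj M s\<^esub> y) = f s x \<ominus>\<^bsub>obj N s\<^esub> f s y"
  using lin_map_minus[OF pers_module[OF assms(1)] pers_module[OF assms(2)] pers_hom_lin[OF assms(3)]]
    assms(4,5) .

lemma pers_hom_comp:
  assumes "pers_hom K L M f" "pers_hom K M N g"
  shows "pers_hom K L N (pers_comp g f)"
  using assms lin_map_comp[OF pers_hom_lin[OF assms(1)] pers_hom_lin[OF assms(2)]]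
    pers_hom_closed[OF assms(1)]
  by (simp add: pers_hom_def pers_comp_def)

lemma pers_hom_id: "pers_hom K M M pers_id"
  by (simp add: pers_hom_def pers_id_def lin_map_def hom_def)

lemma pers_hom_diff:
  fixes M :: "('n::finite, 'k, 'v) pmod" and N :: "('n, 'k, 'w) pmod"
  assumes N: "persistence_module K N" and f: "pers_hom K M N f" and g: "pers_hom K M N g"
  shows "pers_hom K M N (\<lambda>s x. f s x \<ominus>\<^bsub>obj N s\<^esub> g s x)"
  unfolding pers_hom_def
proof safe
  fix s
  show "lin_map K (obj M s) (obj N s) (\<lambda>x. f s x \<ominus>\<^bsub>obj N s\<^esub> g s x)"
    by (intro lin_map_diff pers_module[OF N] pers_hom_lin f g)
next
  fix s t :: "real ^ 'n" and x
  assume st: "s \<le> t" and x: "x \<in> carrier (obj M s)"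
  then show "f t (tr M s t x) \<ominus>\<^bsub>obj N t\<^esub> g t (tr M s t x) = tr N s t (f s x \<ominus>\<^bsub>obj N s\<^esub> g s x)"
    using lin_map_minus[OF pers_module[OF N] pers_module[OF N] tr_lin[OF N st]]
    by (simp add: pers_hom_nat[OF f] pers_hom_nat[OF g] pers_hom_closed[OF f] pers_hom_closed[OF g])
qed

lemma pers_hom_const_zero:
  assumes N: "persistence_module K N"
  shows "pers_hom K M N (\<lambda>s x. \<zero>\<^bsub>obj N s\<^esub>)"
  using N lin_map_zero[OF pers_module[OF N] pers_module[OF N] tr_lin[OF N]]
  by (auto simp: pers_hom_def lin_map_const_zero pers_module)

text \<open>Projectivity is phrased with categorical epimorphisms, whereas the lifting arguments
  produce pointwise surjections; this passes from the latter to the former.\<close>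

lemma pers_epi_if_surj:
  fixes A B :: "('n::finite, 'k, 'v) pmod"
  assumes "pers_hom K A B e" "\<And>s. carrier (obj B s) \<subseteq> e s ` carrier (obj A s)"
  shows "pers_epi K A B e"
  unfolding pers_epi_def pers_eq_def pers_comp_def
proof (intro conjI allI impI ballI)
  show "pers_hom K A B e" by fact
next
  fix C :: "('n, 'k, 'v) pmod" and g h s y
  assume eq: "\<forall>s. \<forall>x\<in>carrier (obj A s). (g s \<circ> e s) x = (h s \<circ> e s) x"
    and "y \<in> carrier (obj B s)"
  then obtain x where "x \<in> carrier (obj A s)" "y = e s x"
    using assms(2) by blast
  then show "g s y = h s y"
    using eq by simp
qed

text \<open>The image of \<open>e\<close> is realised on a subset of the carrier of \<open>B\<close>, so it is again an object over
  the same universe \<open>'v\<close>, as projectivity requires.\<close>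

lemma projective_lift:
  fixes A B Q :: "('n::finite, 'k, 'v) pmod"
  assumes Q: "pers_projective K Q" and A: "persistence_module K A" and B: "persistence_module K B"
    and e: "pers_hom K A B e" and f: "pers_hom K Q B f"
    and im: "\<And>s x. x \<in> carrier (obj Q s) \<Longrightarrow> f s x \<in> e s ` carrier (obj A s)"
  obtains g where "pers_hom K Q A g" "\<And>s x. x \<in> carrier (obj Q s) \<Longrightarrow> e s (g s x) = f s x"
proof -
  define C where
    "C = \<lparr>obj = (\<lambda>s. (obj B s)\<lparr>carrier := e s ` carrier (obj A s)\<rparr>), tr = tr B\<rparr>"
  have sub: "submodule (e s ` carrier (obj A s)) K (obj B s)" for s
    by (intro submodule_image pers_module A B pers_hom_lin e)
  have cl: "x \<in> carrier (obj A s) \<Longrightarrow> e s x \<in> carrier (obj B s)" for s x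
    by (rule pers_hom_closed[OF e])
  have C: "persistence_module K C"
    unfolding persistence_module_def
  proof safe
    fix s show "Module.module K (obj C s)"
      using submodule.submodule_is_module[OF sub pers_module[OF B]] by (simp add: C_def)
  next
    fix s t :: "real ^ 'n" assume st: "s \<le> t"
    show "lin_map K (obj C s) (obj C t) (tr C s t)"
    proof (rule lin_mapI)
      fix x assume "x \<in> carrier (obj C s)"
      then obtain y where y: "y \<in> carrier (obj A s)" and x: "x = e s y"
        by (auto simp: C_def)
      \<comment> \<open>By naturality of \<open>e\<close>, the transition maps of \<open>B\<close>
        carry the image at \<open>s\<close> into the image at \<open>t\<close>.\<close>
      have "tr B s t x = e t (tr A s t y)"
        using pers_hom_nat[OF e st y] x by simp
      then show "tr C s t x \<in> carrier (obj C t)"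
        using lin_map_closed[OF tr_lin[OF A st] y] by (simp add: C_def)
    qed (auto simp: C_def lin_map_add[OF tr_lin[OF B st]] lin_map_smult[OF tr_lin[OF B st]] cl)
  qed (use B in \<open>auto simp: C_def persistence_module_def cl\<close>)
  \<comment> \<open>Corestricted to its image, \<open>e\<close> is pointwise surjective, hence an
    epimorphism, and \<open>f\<close> corestricts to the same image by \<open>im\<close>; so
    projectivity of \<open>Q\<close> applies.\<close>
  have "pers_hom K A C e"
    using e by (auto simp: pers_hom_def C_def lin_map_def hom_def)
  then have "pers_epi K A C e"
    by (rule pers_epi_if_surj) (simp add: C_def)
  moreover have "pers_hom K Q C f"
    using f im by (auto simp: pers_hom_def C_def lin_map_def hom_def)
  ultimately obtain g where "pers_hom K Q A g" "pers_eq Q (pers_comp e g) f"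
    using Q A C unfolding pers_projective_def by blast
  then show thesis
    using that by (simp add: pers_eq_def pers_comp_def)
qed

section \<open>Augmented resolutions and the comparison theorem\<close>

lemma (in abelian_group) minus_eq_zero_iff:
  assumes "x \<in> carrier G" "y \<in> carrier G"
  shows "x \<ominus> y = \<zero> \<longleftrightarrow> x = y"
proof
  assume "x \<ominus> y = \<zero>"
  then have "x \<oplus> \<ominus> y \<oplus> y = y"
    using assms by (simp add: minus_eq)
  then show "x = y"
    using assms by (simp add: a_assoc l_neg)
qed (use assms in \<open>simp add: minus_eq r_neg\<close>)

section \<open>Elementwise rules for complexes and chain maps\<close>

lemma cobj_module: "cochain_complex K X \<Longrightarrow> persistence_module K (cobj X i)"
  by (simp add: cochain_complex_def)

text \<open>The form with \<open>i - 1\<close> singles out the differential entering degree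
  \<open>i\<close>, which is the one used in the inductions on descending degree.\<close>

lemma cdiff_hom: "cochain_complex K X \<Longrightarrow> pers_hom K (cobj X (i - 1)) (cobj X i) (cdiff X (i - 1))"
proof -
  assume "cochain_complex K X"
  then have "pers_hom K (cobj X (i - 1)) (cobj X (i - 1 + 1)) (cdiff X (i - 1))"
    unfolding cochain_complex_def by blast
  then show ?thesis by simp
qed

lemma cdiff_cdiff:
  assumes "cochain_complex K X" "x \<in> carrier (obj (cobj X (i - 1)) s)"
  shows "cdiff X i s (cdiff X (i - 1) s x) = \<zero>\<^bsub>obj (cobj X (i + 1)) s\<^esub>"
proof -
  have "cdiff X (i - 1 + 1) s (cdiff X (i - 1) s x) = \<zero>\<^bsub>obj (cobj X (i - 1 + 2)) s\<^esub>"
    using assms unfolding cochain_complex_def by blast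
  moreover have "i - 1 + 2 = i + 1" by simp
  ultimately show ?thesis by simp
qed

lemma chain_map_hom: "chain_map K X Y \<phi> \<Longrightarrow> pers_hom K (cobj X i) (cobj Y i) (\<phi> i)"
  by (simp add: chain_map_def)

lemma chain_map_comm:
  assumes "chain_map K X Y \<phi>" "x \<in> carrier (obj (cobj X (i - 1)) s)"
  shows "\<phi> i s (cdiff X (i - 1) s x) = cdiff Y (i - 1) s (\<phi> (i - 1) s x)"
proof -
  have "pers_comp (\<phi> (i - 1 + 1)) (cdiff X (i - 1)) s x = pers_comp (cdiff Y (i - 1)) (\<phi> (i - 1)) s x"
    using assms unfolding chain_map_def pers_eq_def by blast
  then show ?thesis by (simp add: pers_comp_def)
qed

lemma chain_map_comp:
  assumes "chain_map K X Y \<phi>" "chain_map K Y Z \<psi>"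
  shows "chain_map K X Z (\<lambda>i. pers_comp (\<psi> i) (\<phi> i))"
  using assms pers_hom_comp[OF chain_map_hom[OF assms(1)] chain_map_hom[OF assms(2)]]
    pers_hom_closed[OF chain_map_hom[OF assms(1)]]
  by (simp add: chain_map_def pers_eq_def pers_comp_def)

lemma pers_zeroD: "pers_zero M \<Longrightarrow> x \<in> carrier (obj M s) \<Longrightarrow> x = \<zero>\<^bsub>obj M s\<^esub>"
  by (auto simp: pers_zero_def)

lemma pers_zero_eq:
  "pers_zero M \<Longrightarrow> x \<in> carrier (obj M s) \<Longrightarrow> y \<in> carrier (obj M s) \<Longrightarrow> x = y"
  by (auto simp: pers_zero_def)

text \<open>The exact sequence \<open>... -> X^-1 -> X^0 -> M -> 0\<close>, stated elementwise.
  Replacing the isomorphism from H^0 by the augmentation \<open>a\<close> removes cosets from the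
  comparison theorem.\<close>

locale augmented_resolution =
  fixes K :: "'k ring" and M :: "('n::finite, 'k, 'v) pmod"
    and X :: "('n, 'k, 'v) pcomplex" and a :: "('n, 'v, 'v) pmor"
  assumes target: "persistence_module K M"
    and complex: "cochain_complex K X"
    and projective: "pers_projective K (cobj X i)"
    and above: "i > 0 \<Longrightarrow> pers_zero (cobj X i)"
    and exact: "i < 0 \<Longrightarrow> x \<in> carrier (obj (cobj X i) s) \<Longrightarrow>
      cdiff X i s x = \<zero>\<^bsub>obj (cobj X (i + 1)) s\<^esub> \<Longrightarrow> x \<in> coboundaries X i s"
    and aug_hom: "pers_hom K (cobj X 0) M a"
    and aug_surj: "carrier (obj M s) \<subseteq> a s ` carrier (obj (cobj X 0) s)"
    and aug_ker: "x \<in> carrier (obj (cobj X 0) s) \<Longrightarrow>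
      a s x = \<zero>\<^bsub>obj M s\<^esub> \<longleftrightarrow> x \<in> coboundaries X 0 s"

text \<open>Dependent choice on naturals, with \<open>n\<close> standing for degree
  \<open>-n\<close>. \<open>C\<close> is the invariant that makes the next choice possible,
  \<open>R\<close> the relation wanted between neighbouring degrees. Chain maps and homotopies are
  both built this way.\<close>

lemma int_descending_choice:
  fixes C :: "int \<Rightarrow> 'a \<Rightarrow> bool"
  assumes "C 0 x" and step: "\<And>i x. i \<le> 0 \<Longrightarrow> C i x \<Longrightarrow> \<exists>y. C (i - 1) y \<and> R i x y"
  obtains g where "g 0 = x" "\<And>i. i \<le> 0 \<Longrightarrow> C i (g i)" "\<And>i. i \<le> 0 \<Longrightarrow> R i (g i) (g (i - 1))"
proof -
  \<comment> \<open>The clause for \<open>n = 0\<close> is part of the invariant because dependent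
    choice alone does not fix the first term.\<close>
  have "\<exists>f. \<forall>n. ((n = 0 \<longrightarrow> f n = x) \<and> C (- int n) (f n)) \<and> R (- int n) (f n) (f (Suc n))"
  proof (rule dependent_nat_choice)
    fix y n assume "(n = 0 \<longrightarrow> y = x) \<and> C (- int n) y"
    then show "\<exists>z. ((Suc n = 0 \<longrightarrow> z = x) \<and> C (- int (Suc n)) z) \<and> R (- int n) y z"
      using step[of "- int n" y] by (auto simp: minus_diff_commute)
  qed (use assms(1) in auto)
  then obtain f where f: "f 0 = x" "\<And>n. C (- int n) (f n)" "\<And>n. R (- int n) (f n) (f (Suc n))"
    by blast
  show thesis
  \<comment> \<open>For positive \<open>i\<close> the value is \<open>f 0\<close>, about which
    nothing is claimed.\<close>
  proof (rule that[of "\<lambda>i. f (nat (- i))"])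
    fix i :: int assume i: "i \<le> 0"
    show "C i (f (nat (- i)))" using f(2)[of "nat (- i)"] i by simp
    have "nat (- (i - 1)) = Suc (nat (- i))" using i by simp
    then show "R i (f (nat (- i))) (f (nat (- (i - 1))))"
      using f(3)[of "nat (- i)"] i by simp
  qed (use f in simp)
qed

text \<open>A set rather than a predicate, because morphisms of the homotopy category are themselves
  sets of chain maps and are to be compared with these.\<close>

definition covering ::
  "'k ring \<Rightarrow> ('n::finite, 'k, 'v) pcomplex \<Rightarrow> ('n, 'v, 'v) pmor \<Rightarrow>
   ('n, 'k, 'v) pcomplex \<Rightarrow> ('n, 'v, 'v) pmor \<Rightarrow> ('n, 'v, 'v) pmor \<Rightarrow> ('n, 'v) cmor set" where
  "covering K X a Y b f = {\<phi>. chain_map K X Y \<phi> \<and>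
     (\<forall>s. \<forall>x\<in>carrier (obj (cobj X 0) s). b s (\<phi> 0 s x) = f s (a s x))}"

text \<open>Existence half of the comparison theorem: projectivity lifts \<open>f\<close> after
  \<open>a\<close> through the surjection \<open>b\<close>, and then, one degree at a time, lifts
  the map already found after \<open>d\<close> through the differential of \<open>Y\<close>.\<close>

lemma covering_nonempty:
  assumes "augmented_resolution K M X a" "augmented_resolution K N Y b" "pers_hom K M N f"
  shows "covering K X a Y b f \<noteq> {}"
proof -
  interpret X: augmented_resolution K M X a by fact
  interpret Y: augmented_resolution K N Y b by fact
  note closed = pers_hom_closed[OF X.aug_hom] pers_hom_closed[OF assms(3)]
    pers_hom_closed[OF cdiff_hom[OF X.complex]] pers_hom_closed[OF cdiff_hom[OF Y.complex]]
  have "\<And>s x. x \<in> carrier (obj (cobj X 0) s) \<Longrightarrow> pers_comp f a s x \<in> b s ` carrier (obj (cobj Y 0) s)"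
    using Y.aug_surj closed(1,2) unfolding pers_comp_def comp_apply by blast
  then obtain g0 where g0: "pers_hom K (cobj X 0) (cobj Y 0) g0"
    and b_g0: "\<And>s x. x \<in> carrier (obj (cobj X 0) s) \<Longrightarrow> b s (g0 s x) = f s (a s x)"
    using projective_lift[OF X.projective cobj_module[OF Y.complex] Y.target Y.aug_hom
        pers_hom_comp[OF X.aug_hom assms(3)]]
    unfolding pers_comp_def comp_apply by blast
  \<comment> \<open>\<open>C i g\<close> says that \<open>g\<close> maps coboundaries to
    coboundaries, so that \<open>g\<close> after \<open>d\<close> can be lifted to degree
    \<open>i - 1\<close>. \<open>R\<close> is the commuting square from degree \<open>i - 1\<close>
    to degree \<open>i\<close>.\<close>
  define C where "C = (\<lambda>i g. pers_hom K (cobj X i) (cobj Y i) g \<and>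
    (\<forall>s. \<forall>x\<in>carrier (obj (cobj X (i - 1)) s). g s (cdiff X (i - 1) s x) \<in> coboundaries Y i s))"
  define R where "R = (\<lambda>i g g'. \<forall>s. \<forall>x\<in>carrier (obj (cobj X (i - 1)) s).
    cdiff Y (i - 1) s (g' s x) = g s (cdiff X (i - 1) s x))"
  \<comment> \<open>\<open>a\<close> kills coboundaries, so \<open>b\<close> kills their images
    under \<open>g0\<close>, and the kernel of \<open>b\<close> consists of coboundaries.\<close>
  have C0: "C 0 g0"
    unfolding C_def
  proof (intro conjI allI ballI g0)
    fix s x assume x: "x \<in> carrier (obj (cobj X (0 - 1)) s)"
    then have dx: "cdiff X (0 - 1) s x \<in> carrier (obj (cobj X 0) s)"
      by (rule closed)
    then have "a s (cdiff X (0 - 1) s x) = \<zero>\<^bsub>obj M s\<^esub>"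
      using x by (simp add: X.aug_ker coboundaries_def)
    then have "b s (g0 s (cdiff X (0 - 1) s x)) = \<zero>\<^bsub>obj N s\<^esub>"
      using b_g0[OF dx] pers_hom_zero[OF X.target Y.target assms(3)] by simp
    then show "g0 s (cdiff X (0 - 1) s x) \<in> coboundaries Y 0 s"
      using Y.aug_ker pers_hom_closed[OF g0 dx] by blast
  qed
  have step: "\<exists>g'. C (i - 1) g' \<and> R i g g'" if i: "i \<le> 0" and Cg: "C i g" for i g
  proof -
    have g: "pers_hom K (cobj X i) (cobj Y i) g" using Cg by (simp add: C_def)
    have "\<And>s x. x \<in> carrier (obj (cobj X (i - 1)) s) \<Longrightarrow>
        pers_comp g (cdiff X (i - 1)) s x \<in> cdiff Y (i - 1) s ` carrier (obj (cobj Y (i - 1)) s)"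
      using Cg by (simp add: C_def pers_comp_def coboundaries_def)
    then obtain g' where g': "pers_hom K (cobj X (i - 1)) (cobj Y (i - 1)) g'"
      and d_g': "\<And>s x. x \<in> carrier (obj (cobj X (i - 1)) s) \<Longrightarrow>
        cdiff Y (i - 1) s (g' s x) = g s (cdiff X (i - 1) s x)"
      using projective_lift[OF X.projective cobj_module[OF Y.complex] cobj_module[OF Y.complex]
          cdiff_hom[OF Y.complex] pers_hom_comp[OF cdiff_hom[OF X.complex] g]]
      unfolding pers_comp_def comp_apply by blast
    \<comment> \<open>The invariant one degree lower: \<open>d g' d = g d d = 0\<close>, so
      \<open>g' d x\<close> is a cocycle, and exactness in negative degrees makes it a
      coboundary.\<close>
    have "g' s (cdiff X (i - 1 - 1) s x) \<in> coboundaries Y (i - 1) s"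
      if x: "x \<in> carrier (obj (cobj X (i - 1 - 1)) s)" for s x
    proof (rule Y.exact)
      show "i - 1 < 0" using i by simp
      have dx: "cdiff X (i - 1 - 1) s x \<in> carrier (obj (cobj X (i - 1)) s)"
        using x by (rule closed)
      show "g' s (cdiff X (i - 1 - 1) s x) \<in> carrier (obj (cobj Y (i - 1)) s)"
        using dx by (rule pers_hom_closed[OF g'])
      show "cdiff Y (i - 1) s (g' s (cdiff X (i - 1 - 1) s x)) = \<zero>\<^bsub>obj (cobj Y (i - 1 + 1)) s\<^esub>"
        using d_g'[OF dx] cdiff_cdiff[OF X.complex x]
          pers_hom_zero[OF cobj_module[OF X.complex] cobj_module[OF Y.complex] g] by simp
    qed
    then show ?thesis
      using g' d_g' unfolding C_def R_def by blast
  qed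
  obtain g where g: "g 0 = g0" "\<And>i. i \<le> 0 \<Longrightarrow> C i (g i)" "\<And>i. i \<le> 0 \<Longrightarrow> R i (g i) (g (i - 1))"
    using int_descending_choice[of C g0 R, OF C0 step] by blast
  \<comment> \<open>\<open>Y\<close> vanishes in positive degrees, so zero is the right value there,
    and the squares leaving degrees \<open>i \<ge> 0\<close> commute because they end in a zero
    module.\<close>
  define \<phi> where "\<phi> = (\<lambda>i. if i > 0 then (\<lambda>s x. \<zero>\<^bsub>obj (cobj Y i) s\<^esub>) else g i)"
  have hom: "pers_hom K (cobj X i) (cobj Y i) (\<phi> i)" for i
    using g(2)[of i] by (auto simp: \<phi>_def C_def pers_hom_const_zero cobj_module[OF Y.complex])
  have comm: "\<phi> (i + 1) s (cdiff X i s x) = cdiff Y i s (\<phi> i s x)"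
    if x: "x \<in> carrier (obj (cobj X i) s)" for i s x
  proof (cases "i < 0")
    case True
    then show ?thesis
      using g(3)[of "i + 1"] x by (simp add: \<phi>_def R_def)
  next
    case False
    then have "pers_zero (cobj Y (i + 1))" by (intro Y.above) simp
    moreover have "\<phi> (i + 1) s (cdiff X i s x) \<in> carrier (obj (cobj Y (i + 1)) s)"
      using closed(3)[of x "i + 1" s] x by (intro pers_hom_closed[OF hom]) simp
    moreover have "cdiff Y i s (\<phi> i s x) \<in> carrier (obj (cobj Y (i + 1)) s)"
      using closed(4)[of "\<phi> i s x" "i + 1" s] pers_hom_closed[OF hom x] by simp
    ultimately show ?thesis by (rule pers_zero_eq)
  qed
  have "\<phi> \<in> covering K X a Y b f"
    using hom comm b_g0 g(1)
    by (auto simp: covering_def chain_map_def pers_eq_def pers_comp_def \<phi>_def)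
  then show ?thesis by blast
qed

text \<open>Uniqueness half of the comparison theorem. The difference \<open>D\<close> of the two
  maps is killed by \<open>b\<close> in degree 0, hence lifts through the differential of
  \<open>Y\<close>; below that, \<open>D\<close> minus the part accounted for by \<open>h d\<close>
  is a cocycle and lifts again.\<close>

lemma chain_homotopic_if_aug_eq:
  assumes "augmented_resolution K M X a" "augmented_resolution K N Y b"
    and \<phi>: "chain_map K X Y \<phi>" and \<psi>: "chain_map K X Y \<psi>"
    and eq: "\<And>s x. x \<in> carrier (obj (cobj X 0) s) \<Longrightarrow> b s (\<phi> 0 s x) = b s (\<psi> 0 s x)"
  shows "chain_homotopic K X Y \<phi> \<psi>"
proof -
  interpret X: augmented_resolution K M X a by fact
  interpret Y: augmented_resolution K N Y b by fact
  note Xm = cobj_module[OF X.complex] and Ym = cobj_module[OF Y.complex]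
  note dX = cdiff_hom[OF X.complex] and dY = cdiff_hom[OF Y.complex]
  note closed = pers_hom_closed[OF dX] pers_hom_closed[OF dY]
  have group: "abelian_group (obj (cobj Y i) s)" "abelian_group (obj N s)" for i s
    by (rule module.axioms(2)[OF pers_module[OF Ym]], rule module.axioms(2)[OF pers_module[OF Y.target]])
  define D where "D = (\<lambda>i s x. \<phi> i s x \<ominus>\<^bsub>obj (cobj Y i) s\<^esub> \<psi> i s x)"
  have D: "pers_hom K (cobj X i) (cobj Y i) (D i)" for i
    unfolding D_def by (intro pers_hom_diff Ym chain_map_hom[OF \<phi>] chain_map_hom[OF \<psi>])
  have D_comm: "D i s (cdiff X (i - 1) s x) = cdiff Y (i - 1) s (D (i - 1) s x)"
    if "x \<in> carrier (obj (cobj X (i - 1)) s)" for i s x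
    using that pers_hom_minus[OF Ym Ym dY]
    by (simp add: D_def chain_map_comm[OF \<phi>] chain_map_comm[OF \<psi>]
        pers_hom_closed[OF chain_map_hom[OF \<phi>]] pers_hom_closed[OF chain_map_hom[OF \<psi>]])
  have "D 0 s x \<in> cdiff Y (0 - 1) s ` carrier (obj (cobj Y (0 - 1)) s)"
    if x: "x \<in> carrier (obj (cobj X 0) s)" for s x
  proof -
    have "b s (D 0 s x) = \<zero>\<^bsub>obj N s\<^esub>"
      using x eq pers_hom_minus[OF Ym Y.target Y.aug_hom]
      by (simp add: D_def pers_hom_closed[OF chain_map_hom[OF \<phi>]]
          pers_hom_closed[OF chain_map_hom[OF \<psi>]] pers_hom_closed[OF Y.aug_hom]
          abelian_group.minus_eq_zero_iff[OF group(2)])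
    then show ?thesis
      using Y.aug_ker pers_hom_closed[OF D x] by (simp add: coboundaries_def)
  qed
  then obtain h0 where h0: "pers_hom K (cobj X 0) (cobj Y (0 - 1)) h0"
    and d_h0: "\<And>s x. x \<in> carrier (obj (cobj X 0) s) \<Longrightarrow> cdiff Y (0 - 1) s (h0 s x) = D 0 s x"
    using projective_lift[OF X.projective Ym Ym dY D] by blast
  \<comment> \<open>\<open>C i h\<close> is the homotopy identity in degree \<open>i\<close>
    evaluated on coboundaries, where the term with the next homotopy component vanishes.
    \<open>R\<close> is the homotopy identity in degree \<open>i - 1\<close>, solved for
    \<open>d h'\<close>.\<close>
  define C where "C = (\<lambda>i h. pers_hom K (cobj X i) (cobj Y (i - 1)) h \<and>
    (\<forall>s. \<forall>x\<in>carrier (obj (cobj X (i - 1)) s).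
      cdiff Y (i - 1) s (h s (cdiff X (i - 1) s x)) = D i s (cdiff X (i - 1) s x)))"
  define R where "R = (\<lambda>i h h'. \<forall>s. \<forall>x\<in>carrier (obj (cobj X (i - 1)) s).
    cdiff Y (i - 1 - 1) s (h' s x) =
      D (i - 1) s x \<ominus>\<^bsub>obj (cobj Y (i - 1)) s\<^esub> h s (cdiff X (i - 1) s x))"
  have C0: "C 0 h0"
    unfolding C_def by (intro conjI allI ballI h0 d_h0 closed)
  have step: "\<exists>h'. C (i - 1) h' \<and> R i h h'" if i: "i \<le> 0" and Ch: "C i h" for i h
  proof -
    have h: "pers_hom K (cobj X i) (cobj Y (i - 1)) h" using Ch by (simp add: C_def)
    define E where "E = (\<lambda>s x. D (i - 1) s x \<ominus>\<^bsub>obj (cobj Y (i - 1)) s\<^esub>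
      pers_comp h (cdiff X (i - 1)) s x)"
    have E: "pers_hom K (cobj X (i - 1)) (cobj Y (i - 1)) E"
      unfolding E_def by (intro pers_hom_diff Ym D pers_hom_comp[OF dX h])
    \<comment> \<open>\<open>E\<close> consists of cocycles: \<open>d E = d D - d h d\<close>, where
      \<open>d D = D d\<close> and the invariant gives \<open>d h d = D d\<close>.\<close>
    have "E s x \<in> coboundaries Y (i - 1) s" if x: "x \<in> carrier (obj (cobj X (i - 1)) s)" for s x
    proof (rule Y.exact)
      show "i - 1 < 0" using i by simp
      show "E s x \<in> carrier (obj (cobj Y (i - 1)) s)"
        using x by (rule pers_hom_closed[OF E])
      have "cdiff Y (i - 1) s (E s x) = cdiff Y (i - 1) s (D (i - 1) s x)
          \<ominus>\<^bsub>obj (cobj Y i) s\<^esub> cdiff Y (i - 1) s (h s (cdiff X (i - 1) s x))"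
        using x pers_hom_minus[OF Ym Ym dY]
        by (simp add: E_def pers_comp_def pers_hom_closed[OF D] pers_hom_closed[OF h] closed)
      also have "\<dots> = \<zero>\<^bsub>obj (cobj Y i) s\<^esub>"
        using Ch x by (simp add: C_def D_comm[symmetric] pers_hom_closed[OF D] closed
            abelian_group.minus_eq_zero_iff[OF group(1)])
      finally show "cdiff Y (i - 1) s (E s x) = \<zero>\<^bsub>obj (cobj Y (i - 1 + 1)) s\<^esub>"
        by simp
    qed
    then obtain h' where h': "pers_hom K (cobj X (i - 1)) (cobj Y (i - 1 - 1)) h'"
      and d_h': "\<And>s x. x \<in> carrier (obj (cobj X (i - 1)) s) \<Longrightarrow>
        cdiff Y (i - 1 - 1) s (h' s x) = E s x"
      using projective_lift[OF X.projective Ym Ym dY E] unfolding coboundaries_def by blast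
    \<comment> \<open>The invariant one degree lower: on coboundaries the correction
      \<open>h d\<close> in \<open>E\<close> is zero because \<open>d d = 0\<close>.\<close>
    have "cdiff Y (i - 1 - 1) s (h' s (cdiff X (i - 1 - 1) s x)) = D (i - 1) s (cdiff X (i - 1 - 1) s x)"
      if x: "x \<in> carrier (obj (cobj X (i - 1 - 1)) s)" for s x
    proof -
      interpret Y': abelian_group "obj (cobj Y (i - 1)) s" by (rule group)
      show ?thesis
        using d_h'[OF closed(1)[OF x]] cdiff_cdiff[OF X.complex x] pers_hom_zero[OF Xm Ym h]
          pers_hom_closed[OF D closed(1)[OF x]]
        by (simp add: E_def pers_comp_def Y'.minus_eq)
    qed
    then show ?thesis
      using h' d_h' unfolding C_def R_def E_def pers_comp_def by auto
  qed
  obtain g where g: "g 0 = h0" "\<And>i. i \<le> 0 \<Longrightarrow> C i (g i)" "\<And>i. i \<le> 0 \<Longrightarrow> R i (g i) (g (i - 1))"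
    using int_descending_choice[of C h0 R, OF C0 step] by blast
  define h where "h = (\<lambda>i. if i > 0 then (\<lambda>s x. \<zero>\<^bsub>obj (cobj Y (i - 1)) s\<^esub>) else g i)"
  have h: "pers_hom K (cobj X i) (cobj Y (i - 1)) (h i)" for i
    using g(2)[of i] by (auto simp: h_def C_def pers_hom_const_zero Ym)
  have "D i s x = cdiff Y (i - 1) s (h i s x) \<oplus>\<^bsub>obj (cobj Y i) s\<^esub> h (i + 1) s (cdiff X i s x)"
    if x: "x \<in> carrier (obj (cobj X i) s)" for i s x
  proof -
    interpret Yi: abelian_group "obj (cobj Y i) s" by (rule group)
    have cl: "D i s x \<in> carrier (obj (cobj Y i) s)"
      "cdiff Y (i - 1) s (h i s x) \<in> carrier (obj (cobj Y i) s)"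
      "h (i + 1) s (cdiff X i s x) \<in> carrier (obj (cobj Y i) s)"
      using x closed(1)[of x "i + 1" s] pers_hom_closed[OF h, of "cdiff X i s x" "i + 1" s]
      by (simp_all add: pers_hom_closed[OF D] pers_hom_closed[OF h] closed(2))
    \<comment> \<open>Below degree 0 the identity is \<open>R\<close> at index \<open>i + 1\<close>;
      in degree 0 it is the equation for \<open>h0\<close>, since the component of \<open>h\<close>
      in degree 1 is zero; above, both sides lie in a zero module.\<close>
    consider "i < 0" | "i = 0" | "i > 0" by linarith
    then show ?thesis
    proof cases
      case 1
      then have "cdiff Y (i - 1) s (h i s x) =
          D i s x \<ominus>\<^bsub>obj (cobj Y i) s\<^esub> h (i + 1) s (cdiff X i s x)"
        using g(3)[of "i + 1"] x by (simp add: h_def R_def)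
      then show ?thesis
        using cl by (simp add: Yi.minus_eq Yi.a_assoc Yi.l_neg)
    next
      case 2
      then show ?thesis
        using d_h0 x cl Yi.r_zero[unfolded 2] by (simp add: h_def g(1))
    next
      case 3
      show ?thesis
        by (rule pers_zero_eq[OF Y.above[OF 3]]) (use cl in auto)
    qed
  qed
  then show ?thesis
    using h unfolding chain_homotopic_def D_def by blast
qed

text \<open>In degree 0 the two maps differ by \<open>d h + h d\<close>. The second term vanishes
  because \<open>X\<close> is zero in degree 1, and the first is a coboundary, hence killed by
  \<open>b\<close>.\<close>

lemma aug_eq_if_chain_homotopic:
  assumes "augmented_resolution K M X a" "augmented_resolution K N Y b"
    and \<phi>: "chain_map K X Y \<phi>" and \<psi>: "chain_map K X Y \<psi>"
    and "chain_homotopic K X Y \<phi> \<psi>" and x: "x \<in> carrier (obj (cobj X 0) s)"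
  shows "b s (\<phi> 0 s x) = b s (\<psi> 0 s x)"
proof -
  interpret X: augmented_resolution K M X a by fact
  interpret Y: augmented_resolution K N Y b by fact
  note Xm = cobj_module[OF X.complex] and Ym = cobj_module[OF Y.complex]
  interpret Y0: module K "obj (cobj Y 0) s" by (rule pers_module[OF Ym])
  interpret N: module K "obj N s" by (rule pers_module[OF Y.target])
  note cl = pers_hom_closed[OF chain_map_hom[OF \<phi>] x] pers_hom_closed[OF chain_map_hom[OF \<psi>] x]
  obtain h where h: "\<And>i. pers_hom K (cobj X i) (cobj Y (i - 1)) (h i)"
    and eq: "\<And>i s x. x \<in> carrier (obj (cobj X i) s) \<Longrightarrow>
      \<phi> i s x \<ominus>\<^bsub>obj (cobj Y i) s\<^esub> \<psi> i s x =
      cdiff Y (i - 1) s (h i s x) \<oplus>\<^bsub>obj (cobj Y i) s\<^esub> h (i + 1) s (cdiff X i s x)"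
    using assms(5) unfolding chain_homotopic_def by blast
  have "cdiff X 0 s x = \<zero>\<^bsub>obj (cobj X 1) s\<^esub>"
    using pers_hom_closed[OF cdiff_hom[OF X.complex, of 1]] x by (intro pers_zeroD X.above) auto
  then have "h 1 s (cdiff X 0 s x) = \<zero>\<^bsub>obj (cobj Y 0) s\<^esub>"
    using pers_hom_zero[OF Xm Ym h[of 1]] by simp
  moreover have "cdiff Y (0 - 1) s (h 0 s x) \<in> carrier (obj (cobj Y 0) s)"
    by (intro pers_hom_closed[OF cdiff_hom[OF Y.complex]] pers_hom_closed[OF h] x)
  ultimately have "\<phi> 0 s x \<ominus>\<^bsub>obj (cobj Y 0) s\<^esub> \<psi> 0 s x = cdiff Y (0 - 1) s (h 0 s x)"
    using eq[OF x] by simp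
  also have "\<dots> \<in> coboundaries Y 0 s"
    unfolding coboundaries_def by (intro imageI pers_hom_closed[OF h] x)
  finally have "b s (\<phi> 0 s x \<ominus>\<^bsub>obj (cobj Y 0) s\<^esub> \<psi> 0 s x) = \<zero>\<^bsub>obj N s\<^esub>"
    using Y.aug_ker cl by blast
  then show ?thesis
    using pers_hom_minus[OF Ym Y.target Y.aug_hom cl] pers_hom_closed[OF Y.aug_hom] cl
    by (simp add: N.minus_eq_zero_iff)
qed

section \<open>Homotopy classes as sets of coverings\<close>

text \<open>Since \<open>a\<close> is onto, the values of \<open>f\<close> are those of the morphism
  \<open>b\<close> after the degree 0 part of \<open>\<phi>\<close>, and linearity and naturality
  descend along \<open>a\<close>. This shows that the map induced on H^0 is a morphism.\<close>

lemma pers_hom_if_covering: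
  fixes M N :: "('n::finite, 'k, 'v) pmod"
  assumes "augmented_resolution K M X a" "augmented_resolution K N Y b"
    and "\<phi> \<in> covering K X a Y b f"
  shows "pers_hom K M N f"
proof -
  interpret X: augmented_resolution K M X a by fact
  interpret Y: augmented_resolution K N Y b by fact
  have hom: "pers_hom K (cobj X 0) N (pers_comp b (\<phi> 0))"
    using assms(3) by (intro pers_hom_comp[OF chain_map_hom Y.aug_hom]) (auto simp: covering_def)
  have cover: "f s (a s x) = pers_comp b (\<phi> 0) s x" if "x \<in> carrier (obj (cobj X 0) s)" for s x
    using assms(3) that by (simp add: covering_def pers_comp_def)
  have lift: "\<exists>x\<in>carrier (obj (cobj X 0) s). m = a s x" if "m \<in> carrier (obj M s)" for s m
    using X.aug_surj that by blast
  interpret X0: module K "obj (cobj X 0) s" for s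
    by (rule pers_module[OF cobj_module[OF X.complex]])
  show ?thesis
    unfolding pers_hom_def
  proof (intro conjI allI impI ballI)
    fix s
    show "lin_map K (obj M s) (obj N s) (f s)"
    proof (rule lin_mapI)
      fix m assume "m \<in> carrier (obj M s)"
      then obtain x where "x \<in> carrier (obj (cobj X 0) s)" "m = a s x"
        using lift by blast
      then show "f s m \<in> carrier (obj N s)"
        using pers_hom_closed[OF hom] by (simp add: cover)
    next
      fix m n assume mn: "m \<in> carrier (obj M s)" "n \<in> carrier (obj M s)"
      obtain x where "x \<in> carrier (obj (cobj X 0) s)" "m = a s x"
        using lift[OF mn(1)] by blast
      moreover obtain y where "y \<in> carrier (obj (cobj X 0) s)" "n = a s y"
        using lift[OF mn(2)] by blast
      ultimately show "f s (m \<oplus>\<^bsub>obj M s\<^esub> n) = f s m \<oplus>\<^bsub>obj N s\<^esub> f s n"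
        using lin_map_add[OF pers_hom_lin[OF hom]]
        by (simp add: lin_map_add[OF pers_hom_lin[OF X.aug_hom], symmetric] cover)
    next
      fix c m assume c: "c \<in> carrier K" and "m \<in> carrier (obj M s)"
      then obtain x where "x \<in> carrier (obj (cobj X 0) s)" "m = a s x"
        using lift by blast
      then show "f s (c \<odot>\<^bsub>obj M s\<^esub> m) = c \<odot>\<^bsub>obj N s\<^esub> f s m"
        using c lin_map_smult[OF pers_hom_lin[OF hom]]
        by (simp add: lin_map_smult[OF pers_hom_lin[OF X.aug_hom], symmetric] cover)
    qed
  next
    fix s t :: "real ^ 'n" and m
    assume st: "s \<le> t" and "m \<in> carrier (obj M s)"
    then obtain x where x: "x \<in> carrier (obj (cobj X 0) s)" "m = a s x"
      using lift by blast
    then show "f t (tr M s t m) = tr N s t (f s m)"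
      using pers_hom_nat[OF hom st] lin_map_closed[OF tr_lin[OF cobj_module[OF X.complex] st] x(1)]
      by (simp add: pers_hom_nat[OF X.aug_hom st, symmetric] cover)
  qed
qed

text \<open>By \<open>chain_homotopic_if_aug_eq\<close> and
  \<open>aug_eq_if_chain_homotopic\<close>, homotopy amounts to agreement in degree 0 after
  \<open>b\<close>, and covering \<open>f\<close> prescribes exactly those values.\<close>

lemma hclass_covering:
  assumes "augmented_resolution K M X a" "augmented_resolution K N Y b"
    and "\<phi> \<in> covering K X a Y b f"
  shows "hclass K X Y \<phi> = covering K X a Y b f"
proof -
  have "\<psi> \<in> hclass K X Y \<phi> \<longleftrightarrow> chain_map K X Y \<psi> \<and>
      (\<forall>s. \<forall>x\<in>carrier (obj (cobj X 0) s). b s (\<phi> 0 s x) = b s (\<psi> 0 s x))" for \<psi>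
    using assms(3) chain_homotopic_if_aug_eq[OF assms(1,2)] aug_eq_if_chain_homotopic[OF assms(1,2)]
    unfolding hclass_def homotopy_rel_def covering_def by blast
  then show ?thesis
    using assms(3) by (auto simp: covering_def)
qed

lemma covering_cong:
  assumes "pers_hom K (cobj X 0) M a" "pers_eq M f g"
  shows "covering K X a Y b f = covering K X a Y b g"
  using assms pers_hom_closed[OF assms(1)] unfolding covering_def pers_eq_def by auto

text \<open>One common chain map suffices: it covers both \<open>f\<close> and \<open>g\<close>, and
  every element of \<open>M\<close> has the form \<open>a s x\<close>.\<close>

lemma pers_eq_if_covering_eq:
  assumes "augmented_resolution K M X a" "augmented_resolution K N Y b"
    and f: "pers_hom K M N f" and eq: "covering K X a Y b f = covering K X a Y b g"
  shows "pers_eq M f g"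
  unfolding pers_eq_def
proof (intro allI ballI)
  fix s m assume "m \<in> carrier (obj M s)"
  then obtain x where x: "x \<in> carrier (obj (cobj X 0) s)" "m = a s x"
    using augmented_resolution.aug_surj[OF assms(1)] by blast
  obtain \<phi> where "\<phi> \<in> covering K X a Y b f" "\<phi> \<in> covering K X a Y b g"
    using covering_nonempty[OF assms(1,2) f] eq by blast
  then show "f s m = g s m"
    using x by (auto simp: covering_def)
qed

lemma covering_in_K_hom:
  assumes "augmented_resolution K M X a" "augmented_resolution K N Y b" "pers_hom K M N f"
  shows "covering K X a Y b f \<in> K_hom K X Y"
proof -
  obtain \<phi> where \<phi>: "\<phi> \<in> covering K X a Y b f"
    using covering_nonempty[OF assms] by blast
  then have "hclass K X Y \<phi> \<in> K_hom K X Y"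
    unfolding K_hom_def hclass_def by (intro quotientI) (simp add: covering_def)
  then show ?thesis
    by (simp add: hclass_covering[OF assms(1,2) \<phi>])
qed

section \<open>Composition of coverings\<close>

lemma covering_comp:
  assumes \<phi>: "\<phi> \<in> covering K X a Y b f" and \<psi>: "\<psi> \<in> covering K Y b Z c g"
  shows "(\<lambda>i. pers_comp (\<psi> i) (\<phi> i)) \<in> covering K X a Z c (pers_comp g f)"
proof -
  have "chain_map K X Y \<phi>" "chain_map K Y Z \<psi>"
    using assms by (simp_all add: covering_def)
  then show ?thesis
    using assms chain_map_comp[of K X Y \<phi> Z \<psi>] pers_hom_closed[OF chain_map_hom[of K X Y \<phi>]]
    by (simp add: covering_def pers_comp_def)
qed

text \<open>Any two representatives compose to a chain map covering the composite, so the union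
  defining \<open>K_comp\<close> has a constant term; it equals that term because both index sets
  are nonempty.\<close>

lemma K_comp_covering:
  assumes "augmented_resolution K L X a" "augmented_resolution K M Y b" "augmented_resolution K N Z c"
    and "pers_hom K L M f" "pers_hom K M N g"
  shows "K_comp K X Z (covering K Y b Z c g) (covering K X a Y b f) = covering K X a Z c (pers_comp g f)"
proof -
  have "K_comp K X Z (covering K Y b Z c g) (covering K X a Y b f) =
      (\<Union>\<psi>\<in>covering K Y b Z c g. \<Union>\<phi>\<in>covering K X a Y b f. covering K X a Z c (pers_comp g f))"
    unfolding K_comp_def by (intro SUP_cong refl hclass_covering[OF assms(1,3)] covering_comp)
  then show ?thesis
    using covering_nonempty[OF assms(1,2,4)] covering_nonempty[OF assms(2,3,5)] by simp
qed


section \<open>Shifts\<close>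

lemma pshift_0: "pshift 0 M = M"
  by (simp add: pshift_def vec_0)

lemma pshift_simps [simp]:
  "obj (pshift \<epsilon> M) s = obj M (s + vec \<epsilon>)"
  "tr (pshift \<epsilon> M) s t = tr M (s + vec \<epsilon>) (t + vec \<epsilon>)"
  by (simp_all add: pshift_def)

lemma cshift_simps [simp]:
  "cobj (cshift \<epsilon> X) i = pshift \<epsilon> (cobj X i)"
  "cdiff (cshift \<epsilon> X) i = mor_shift \<epsilon> (cdiff X i)"
  by (simp_all add: cshift_def)

lemma vec_add: "vec \<delta> + vec \<epsilon> = (vec (\<delta> + \<epsilon>) :: real ^ 'n)"
  by (simp add: vec_eq_iff)

lemma add_vec_mono: "s \<le> t \<Longrightarrow> s + vec \<epsilon> \<le> t + (vec \<epsilon> :: real ^ 'n)"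
  by (simp add: less_eq_vec_def)

lemma mor_shift_mor_shift: "mor_shift \<delta> (mor_shift \<epsilon> f) = mor_shift (\<delta> + \<epsilon>) f"
  by (simp add: mor_shift_def add.assoc vec_add)

section \<open>Invariance under the shift\<close>

lemma persistence_module_pshift: "persistence_module K M \<Longrightarrow> persistence_module K (pshift \<epsilon> M)"
  by (simp add: persistence_module_def add_vec_mono)

lemma pers_hom_mor_shift:
  "pers_hom K M N f \<Longrightarrow> pers_hom K (pshift \<epsilon> M) (pshift \<epsilon> N) (mor_shift \<epsilon> f)"
  by (simp add: pers_hom_def mor_shift_def add_vec_mono)

lemma pers_eq_mor_shift:
  "pers_eq M f g \<Longrightarrow> pers_eq (pshift \<epsilon> M) (mor_shift \<epsilon> f) (mor_shift \<epsilon> g)"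
  by (simp add: pers_eq_def mor_shift_def)

lemma pers_comp_mor_shift:
  "pers_comp (mor_shift \<epsilon> g) (mor_shift \<epsilon> f) = mor_shift \<epsilon> (pers_comp g f)"
  by (simp add: pers_comp_def mor_shift_def fun_eq_iff)

text \<open>The shift by \<open>- \<epsilon>\<close> is inverse to the shift by
  \<open>\<epsilon>\<close>, so a pair of test morphisms out of \<open>B[\<epsilon>]\<close> can be
  moved back to \<open>B\<close>.\<close>

lemma pers_epi_mor_shift:
  fixes A B :: "('n::finite, 'k, 'v) pmod"
  assumes "pers_epi K A B e"
  shows "pers_epi K (pshift \<epsilon> A) (pshift \<epsilon> B) (mor_shift \<epsilon> e)"
  unfolding pers_epi_def
proof (intro conjI allI impI)
  show "pers_hom K (pshift \<epsilon> A) (pshift \<epsilon> B) (mor_shift \<epsilon> e)"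
    using assms by (simp add: pers_epi_def pers_hom_mor_shift)
next
  fix C :: "('n, 'k, 'v) pmod" and g h
  assume C: "persistence_module K C" and g: "pers_hom K (pshift \<epsilon> B) C g"
    and h: "pers_hom K (pshift \<epsilon> B) C h"
    and eq: "pers_eq (pshift \<epsilon> A) (pers_comp g (mor_shift \<epsilon> e)) (pers_comp h (mor_shift \<epsilon> e))"
  have "pers_eq A (pers_comp (mor_shift (- \<epsilon>) g) e) (pers_comp (mor_shift (- \<epsilon>) h) e)"
    using pers_eq_mor_shift[OF eq, of "- \<epsilon>"]
    by (simp add: pers_comp_mor_shift[symmetric] mor_shift_mor_shift pshift_pshift pshift_0
        mor_shift_def[of 0] vec_0)
  then have "pers_eq B (mor_shift (- \<epsilon>) g) (mor_shift (- \<epsilon>) h)"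
    using assms persistence_module_pshift[OF C, of "- \<epsilon>"]
      pers_hom_mor_shift[OF g, of "- \<epsilon>"] pers_hom_mor_shift[OF h, of "- \<epsilon>"]
    unfolding pers_epi_def pshift_pshift by (simp add: pshift_0)
  then show "pers_eq (pshift \<epsilon> B) g h"
    using pers_eq_mor_shift[of B "mor_shift (- \<epsilon>) g" "mor_shift (- \<epsilon>) h" \<epsilon>]
    by (simp add: mor_shift_mor_shift mor_shift_def[of 0] vec_0)
qed

text \<open>A lifting problem for \<open>Q[\<epsilon>]\<close> is shifted by
  \<open>- \<epsilon>\<close>, solved for \<open>Q\<close>, and its solution shifted back.\<close>

lemma pers_projective_pshift:
  fixes Q :: "('n::finite, 'k, 'v) pmod"
  assumes "pers_projective K Q"
  shows "pers_projective K (pshift \<epsilon> Q)"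
  unfolding pers_projective_def
proof (intro conjI allI impI)
  show "persistence_module K (pshift \<epsilon> Q)"
    using assms by (simp add: pers_projective_def persistence_module_pshift)
next
  fix A B :: "('n, 'k, 'v) pmod" and e f
  assume "persistence_module K A" "persistence_module K B"
    and e: "pers_epi K A B e" and f: "pers_hom K (pshift \<epsilon> Q) B f"
  then have "persistence_module K (pshift (- \<epsilon>) A)" "persistence_module K (pshift (- \<epsilon>) B)"
    "pers_epi K (pshift (- \<epsilon>) A) (pshift (- \<epsilon>) B) (mor_shift (- \<epsilon>) e)"
    "pers_hom K Q (pshift (- \<epsilon>) B) (mor_shift (- \<epsilon>) f)"
    using pers_hom_mor_shift[OF f, of "- \<epsilon>"]
    by (simp_all add: persistence_module_pshift pers_epi_mor_shift pshift_pshift pshift_0)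
  then obtain g where g: "pers_hom K Q (pshift (- \<epsilon>) A) g"
    "pers_eq Q (pers_comp (mor_shift (- \<epsilon>) e) g) (mor_shift (- \<epsilon>) f)"
    using assms unfolding pers_projective_def by blast
  have "pers_hom K (pshift \<epsilon> Q) A (mor_shift \<epsilon> g)"
    using pers_hom_mor_shift[OF g(1), of \<epsilon>] by (simp add: pshift_pshift pshift_0)
  moreover have "pers_eq (pshift \<epsilon> Q) (pers_comp e (mor_shift \<epsilon> g)) f"
    using pers_eq_mor_shift[OF g(2), of \<epsilon>]
    by (simp add: pers_comp_mor_shift[symmetric] mor_shift_mor_shift mor_shift_def[of 0] vec_0)
  ultimately show "\<exists>g. pers_hom K (pshift \<epsilon> Q) A g \<and> pers_eq (pshift \<epsilon> Q) (pers_comp e g) f"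
    by blast
qed

lemma coboundaries_cshift: "coboundaries (cshift \<epsilon> X) j s = coboundaries X j (s + vec \<epsilon>)"
  by (simp add: coboundaries_def mor_shift_def)

text \<open>Exactness and the conditions on the augmentation are read at
  \<open>s + vec \<epsilon>\<close>; projectivity uses that the shift is invertible.\<close>

lemma augmented_resolution_cshift:
  assumes "augmented_resolution K M X a"
  shows "augmented_resolution K (pshift \<epsilon> M) (cshift \<epsilon> X) (mor_shift \<epsilon> a)"
proof -
  interpret augmented_resolution K M X a by fact
  show ?thesis
  proof
    show "cochain_complex K (cshift \<epsilon> X)"
      using complex by (auto simp: cochain_complex_def persistence_module_pshift pers_hom_mor_shift)
        (simp add: mor_shift_def)
    show "pers_zero (cobj (cshift \<epsilon> X) i)" if "i > 0" for i
      using above[OF that] by (simp add: pers_zero_def)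
    show "pers_hom K (cobj (cshift \<epsilon> X) 0) (pshift \<epsilon> M) (mor_shift \<epsilon> a)"
      by (simp add: aug_hom pers_hom_mor_shift)
  qed (use target projective exact aug_surj aug_ker in
      \<open>auto simp: persistence_module_pshift pers_projective_pshift coboundaries_cshift
        mor_shift_def\<close>)
qed

lemma covering_mor_shift:
  assumes "\<phi> \<in> covering K X a Y b f"
  shows "(\<lambda>i. mor_shift \<epsilon> (\<phi> i)) \<in>
    covering K (cshift \<epsilon> X) (mor_shift \<epsilon> a) (cshift \<epsilon> Y) (mor_shift \<epsilon> b) (mor_shift \<epsilon> f)"
  using assms
  by (simp add: covering_def chain_map_def pers_hom_mor_shift pers_comp_mor_shift pers_eq_mor_shift)
    (simp add: mor_shift_def)

lemma K_shift_covering: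
  assumes "augmented_resolution K M X a" "augmented_resolution K N Y b" "pers_hom K M N f"
  shows "K_shift K \<epsilon> X Y (covering K X a Y b f) =
    covering K (cshift \<epsilon> X) (mor_shift \<epsilon> a) (cshift \<epsilon> Y) (mor_shift \<epsilon> b) (mor_shift \<epsilon> f)"
    (is "_ = ?C")
proof -
  have "K_shift K \<epsilon> X Y (covering K X a Y b f) = (\<Union>\<phi>\<in>covering K X a Y b f. ?C)"
    unfolding K_shift_def
    by (intro SUP_cong refl hclass_covering[OF augmented_resolution_cshift[OF assms(1)]
          augmented_resolution_cshift[OF assms(2)]] covering_mor_shift)
  then show ?thesis
    using covering_nonempty[OF assms] by simp
qed

section \<open>Smoothing\<close>

lemma le_add_vec: "\<epsilon> \<ge> 0 \<Longrightarrow> s \<le> s + (vec \<epsilon> :: real ^ 'n)"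
  by (simp add: less_eq_vec_def)

lemma pers_hom_smoothing:
  fixes M :: "('n::finite, 'k, 'v) pmod"
  assumes M: "persistence_module K M" and "\<epsilon> \<ge> 0"
  shows "pers_hom K M (pshift \<epsilon> M) (smoothing \<epsilon> M)"
  unfolding pers_hom_def smoothing_def
proof (intro conjI allI impI ballI)
  fix s
  show "lin_map K (obj M s) (obj (pshift \<epsilon> M) s) (tr M s (s + vec \<epsilon>))"
    using tr_lin[OF M le_add_vec] assms(2) by simp
next
  fix s t :: "real ^ 'n" and x
  assume st: "s \<le> t" and x: "x \<in> carrier (obj M s)"
  have comp: "tr M t u (tr M s t x) = tr M s u x" if "s \<le> t" "t \<le> u" for t u
    using M x that by (simp add: persistence_module_def)
  show "tr M t (t + vec \<epsilon>) (tr M s t x) = tr (pshift \<epsilon> M) s t (tr M s (s + vec \<epsilon>) x)"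
    using comp[OF st le_add_vec[OF assms(2)]] comp[OF le_add_vec[OF assms(2)] add_vec_mono[OF st]]
    by simp
qed

text \<open>Smoothing is a natural transformation from the identity functor to the shift; this is
  naturality of \<open>f\<close> at \<open>s \<le> s + vec \<epsilon>\<close>.\<close>

lemma pers_hom_smoothing_comm:
  assumes "pers_hom K M N f" "\<epsilon> \<ge> 0" "x \<in> carrier (obj M s)"
  shows "mor_shift \<epsilon> f s (smoothing \<epsilon> M s x) = smoothing \<epsilon> N s (f s x)"
  using pers_hom_nat[OF assms(1) le_add_vec[OF assms(2)] assms(3)]
  by (simp add: mor_shift_def smoothing_def)

text \<open>Naturality of smoothing against the differentials makes it a chain map; naturality
  against the augmentation shows that it covers the smoothing of \<open>M\<close>.\<close>

lemma K_smoothing_covering: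
  assumes "augmented_resolution K M X a" "\<epsilon> \<ge> 0"
  shows "K_smoothing K \<epsilon> X = covering K X a (cshift \<epsilon> X) (mor_shift \<epsilon> a) (smoothing \<epsilon> M)"
  unfolding K_smoothing_def
proof (rule hclass_covering[OF assms(1) augmented_resolution_cshift[OF assms(1)]])
  interpret augmented_resolution K M X a by fact
  have "pers_hom K (cobj X i) (cobj X (i + 1)) (cdiff X i)" for i
    using cdiff_hom[OF complex, of "i + 1"] by simp
  from pers_hom_smoothing_comm[OF this assms(2)]
  show "(\<lambda>i. smoothing \<epsilon> (cobj X i))
      \<in> covering K X a (cshift \<epsilon> X) (mor_shift \<epsilon> a) (smoothing \<epsilon> M)"
    using pers_hom_smoothing[OF cobj_module[OF complex] assms(2)]
      pers_hom_smoothing_comm[OF aug_hom assms(2)]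
    by (simp add: covering_def chain_map_def pers_eq_def pers_comp_def)
qed

section \<open>Resolutions from cohomology\<close>

text \<open>In a resolution \<open>X\<close> is zero in degree 1, so all of degree 0 consists of
  cocycles, and this is the projection onto H^0 followed by its identification with the resolved
  module.\<close>

definition augmentation ::
  "('n::finite, 'k, 'v) pcomplex \<Rightarrow> ('n, 'v set, 'v) pmor \<Rightarrow> ('n, 'v, 'v) pmor" where
  "augmentation X \<alpha> = (\<lambda>s x. \<alpha> s (coboundaries X 0 s +>\<^bsub>obj (cobj X 0) s\<^esub> x))"

lemma augmentation_cshift: "augmentation (cshift \<epsilon> X) (mor_shift \<epsilon> \<alpha>) = mor_shift \<epsilon> (augmentation X \<alpha>)"
  by (simp add: augmentation_def mor_shift_def coboundaries_cshift)

text \<open>Replacing \<open>x\<close> by another element of its coset changes \<open>f x\<close> by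
  an element of \<open>C\<close>, so all terms of the union coincide; there is at least one because
  \<open>B\<close> contains zero.\<close>

lemma coset_map_coset:
  assumes "Module.module K V" "Module.module K W" "lin_map K V W f"
    and "subgroup B (add_monoid V)" "subgroup C (add_monoid W)" "f ` B \<subseteq> C" "x \<in> carrier V"
  shows "coset_map W C f (B +>\<^bsub>V\<^esub> x) = C +>\<^bsub>W\<^esub> f x"
proof -
  interpret W: module K W by fact
  have B: "B \<subseteq> carrier V" and C: "C \<subseteq> carrier W"
    using assms(4,5) subgroup.subset by force+
  have "C +>\<^bsub>W\<^esub> f (b \<oplus>\<^bsub>V\<^esub> x) = C +>\<^bsub>W\<^esub> f x" if "b \<in> B" for b
  proof -
    have b: "b \<in> carrier V" "f b \<in> C" "f b \<in> carrier W"
      using that B C assms(6) by auto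
    have "C +>\<^bsub>W\<^esub> f (b \<oplus>\<^bsub>V\<^esub> x) = (C +>\<^bsub>W\<^esub> f b) +>\<^bsub>W\<^esub> f x"
      using b assms(7) lin_map_closed[OF assms(3)]
      by (simp add: lin_map_add[OF assms(3)] W.a_coset_add_assoc[OF C])
    then show ?thesis
      using W.a_coset_join2[OF b(3) assms(5) b(2)] by simp
  qed
  moreover have "B \<noteq> {}"
    using subgroup.one_closed[OF assms(4)] by auto
  ultimately show ?thesis
    by (auto simp: coset_map_def a_r_coset_def'[of V])
qed

section \<open>Coboundaries, cocycles and induced maps on cohomology\<close>

lemma coboundaries_submodule:
  assumes "cochain_complex K X"
  shows "submodule (coboundaries X j s) K (obj (cobj X j) s)"
  unfolding coboundaries_def
  by (intro submodule_image pers_module cobj_module pers_hom_lin cdiff_hom assms)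

lemma coboundaries_subgroup:
  "cochain_complex K X \<Longrightarrow> subgroup (coboundaries X j s) (add_monoid (obj (cobj X j) s))"
  by (rule submodule.axioms(1)[OF coboundaries_submodule])

lemma cohomology_carrier:
  "carrier (obj (cohomology X j) s) =
    (\<lambda>x. coboundaries X j s +>\<^bsub>obj (cobj X j) s\<^esub> x) ` cocycles X j s"
  by (auto simp: cohomology_def Let_def A_RCOSETS_def' a_r_coset_def')

lemma cohomology_simps:
  "zero (obj (cohomology X j) s) = coboundaries X j s"
  "add (obj (cohomology X j) s) = set_add (obj (cobj X j) s)"
  "smult (obj (cohomology X j) s) c =
    coset_map (obj (cobj X j) s) (coboundaries X j s) (\<lambda>x. c \<odot>\<^bsub>obj (cobj X j) s\<^esub> x)"
  "tr (cohomology X j) s t =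
    coset_map (obj (cobj X j) t) (coboundaries X j t) (tr (cobj X j) s t)"
  by (simp_all add: cohomology_def Let_def)

lemma cocycles_0:
  assumes "cochain_complex K X" "pers_zero (cobj X 1)"
  shows "cocycles X 0 s = carrier (obj (cobj X 0) s)"
  using pers_hom_closed[OF cdiff_hom[OF assms(1), of 1]] pers_zeroD[OF assms(2)]
  by (auto simp: cocycles_def a_kernel_def kernel_def)

lemma chain_map_coboundaries:
  assumes "chain_map K X Y \<phi>"
  shows "\<phi> j s ` coboundaries X j s \<subseteq> coboundaries Y j s"
  using pers_hom_closed[OF chain_map_hom[OF assms]]
  by (auto simp: coboundaries_def chain_map_comm[OF assms])

lemma coset_map_chain_map:
  assumes "cochain_complex K X" "cochain_complex K Y" "chain_map K X Y \<phi>"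
    and "x \<in> carrier (obj (cobj X j) s)"
  shows "cohomology_map Y j \<phi> s (coboundaries X j s +>\<^bsub>obj (cobj X j) s\<^esub> x) =
    coboundaries Y j s +>\<^bsub>obj (cobj Y j) s\<^esub> \<phi> j s x"
  unfolding cohomology_map_def
  by (rule coset_map_coset[OF pers_module[OF cobj_module[OF assms(1)]]
        pers_module[OF cobj_module[OF assms(2)]] pers_hom_lin[OF chain_map_hom[OF assms(3)]]
        coboundaries_subgroup[OF assms(1)] coboundaries_subgroup[OF assms(2)]
        chain_map_coboundaries[OF assms(3)] assms(4)])

text \<open>Every element of H^0 is the coset of some \<open>x\<close> in degree 0, and the lifting
  equation at that coset is the covering equation at \<open>x\<close>.\<close>

lemma lifts_iff_covering:
  assumes "cochain_complex K X" "cochain_complex K Y" "pers_zero (cobj X 1)" "chain_map K X Y \<phi>"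
  shows "lifts X \<alpha> Y \<beta> f \<phi> \<longleftrightarrow> \<phi> \<in> covering K X (augmentation X \<alpha>) Y (augmentation Y \<beta>) f"
  using assms(4) coset_map_chain_map[OF assms(1,2,4)]
  by (simp add: lifts_def pers_eq_def pers_comp_def covering_def augmentation_def
      cohomology_carrier cocycles_0[OF assms(1,3)])

lemma pers_iso_inj_on:
  assumes "pers_iso K M N f"
  shows "inj_on (f s) (carrier (obj M s))"
proof -
  obtain g where "pers_eq M (pers_comp g f) pers_id"
    using assms unfolding pers_iso_def by blast
  then show ?thesis
    by (intro inj_on_inverseI[of _ "g s"]) (simp add: pers_eq_def pers_comp_def pers_id_def)
qed

lemma pers_iso_surj:
  assumes "pers_iso K M N f"
  shows "carrier (obj N s) \<subseteq> f s ` carrier (obj M s)"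
proof
  obtain g where g: "pers_hom K N M g" "pers_eq N (pers_comp f g) pers_id"
    using assms unfolding pers_iso_def by blast
  fix y assume y: "y \<in> carrier (obj N s)"
  then have "y = f s (g s y)"
    using g(2) by (simp add: pers_eq_def pers_comp_def pers_id_def)
  then show "y \<in> f s ` carrier (obj M s)"
    using pers_hom_closed[OF g(1) y] by blast
qed

text \<open>Vanishing cohomology gives exactness in negative degrees. In degree 0 the augmentation
  is a quotient map followed by a bijection, hence onto with the coboundaries as kernel.\<close>

lemma augmented_resolution_augmentation:
  fixes M :: "('n::finite, 'k, 'v) pmod" and X :: "('n, 'k, 'v) pcomplex"
  assumes M: "persistence_module K M" and "projective_resolution K M X \<alpha>"
  shows "augmented_resolution K M X (augmentation X \<alpha>)"
proof -
  have X: "cochain_complex K X" and proj: "\<And>i. pers_projective K (cobj X i)"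
    and above: "\<And>i. i > 0 \<Longrightarrow> pers_zero (cobj X i)"
    and acyclic: "\<And>j. j \<noteq> 0 \<Longrightarrow> pers_zero (cohomology X j)"
    and iso: "pers_iso K (cohomology X 0) M \<alpha>"
    using assms(2) by (auto simp: projective_resolution_def)
  note Xm = cobj_module[OF X]
  interpret X: module K "obj (cobj X j) s" for j s by (rule pers_module[OF Xm])
  interpret M: module K "obj M s" for s by (rule pers_module[OF M])
  interpret B: abelian_subgroup "coboundaries X j s" "obj (cobj X j) s" for j s
    by (intro abelian_subgroupI3 additive_subgroup.intro coboundaries_subgroup[OF X]
        X.abelian_group_axioms)
  have \<alpha>: "pers_hom K (cohomology X 0) M \<alpha>"
    using iso by (simp add: pers_iso_def)
  let ?q = "\<lambda>s x. coboundaries X 0 s +>\<^bsub>obj (cobj X 0) s\<^esub> x"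
  have carrier: "carrier (obj (cohomology X 0) s) = ?q s ` carrier (obj (cobj X 0) s)" for s
    using cocycles_0[OF X above] by (simp add: cohomology_carrier)
  have q: "pers_hom K (cobj X 0) (cohomology X 0) ?q"
    unfolding pers_hom_def
  proof (intro conjI allI impI ballI)
    fix s
    show "lin_map K (obj (cobj X 0) s) (obj (cohomology X 0) s) (?q s)"
    proof (rule lin_mapI)
      fix c x assume c: "c \<in> carrier K" and x: "x \<in> carrier (obj (cobj X 0) s)"
      \<comment> \<open>The scalar action on cosets is itself a \<open>coset_map\<close>, computed
        on representatives once multiplication by \<open>c\<close> is known to be linear; this uses
        commutativity of \<open>K\<close>.\<close>
      have smult: "lin_map K (obj (cobj X 0) s) (obj (cobj X 0) s) (\<lambda>x. c \<odot>\<^bsub>obj (cobj X 0) s\<^esub> x)"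
        using c by (intro lin_mapI)
          (auto simp: X.smult_r_distr X.smult_assoc1[symmetric] X.R.m_comm)
      show "?q s (c \<odot>\<^bsub>obj (cobj X 0) s\<^esub> x) = c \<odot>\<^bsub>obj (cohomology X 0) s\<^esub> ?q s x"
        unfolding cohomology_simps
        by (rule coset_map_coset[OF pers_module[OF Xm] pers_module[OF Xm] smult
              coboundaries_subgroup[OF X] coboundaries_subgroup[OF X] image_subsetI x, symmetric])
          (rule submodule.smult_closed[OF coboundaries_submodule[OF X] c])
    qed (auto simp: carrier cohomology_simps B.a_rcos_sum)
  next
    fix s t :: "real ^ 'n" and x
    assume st: "s \<le> t" and x: "x \<in> carrier (obj (cobj X 0) s)"
    have "tr (cobj X j) s t ` coboundaries X j s \<subseteq> coboundaries X j t" for j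
      using lin_map_closed[OF tr_lin[OF Xm st]]
      by (auto simp: coboundaries_def pers_hom_nat[OF cdiff_hom[OF X] st, symmetric])
    then show "?q t (tr (cobj X 0) s t x) = tr (cohomology X 0) s t (?q s x)"
      unfolding cohomology_simps
      by (intro coset_map_coset[OF pers_module[OF Xm] pers_module[OF Xm] tr_lin[OF Xm st]
            coboundaries_subgroup[OF X] coboundaries_subgroup[OF X] _ x, symmetric])
  qed
  have aug: "pers_hom K (cobj X 0) M (augmentation X \<alpha>)"
    using pers_hom_comp[OF q \<alpha>] by (simp add: pers_comp_def augmentation_def comp_def)
  show ?thesis
  proof (unfold_locales; (intro M X proj above aug)?)
    \<comment> \<open>A cocycle defines an element of a zero cohomology module, so its coset is the
      zero coset and contains it.\<close>
    fix i s x
    assume i: "i < 0" and x: "x \<in> carrier (obj (cobj X i) s)"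
      and dx: "cdiff X i s x = \<zero>\<^bsub>obj (cobj X (i + 1)) s\<^esub>"
    then have "x \<in> cocycles X i s"
      by (simp add: cocycles_def a_kernel_def kernel_def)
    then have "coboundaries X i s +>\<^bsub>obj (cobj X i) s\<^esub> x \<in> carrier (obj (cohomology X i) s)"
      by (simp add: cohomology_carrier)
    from pers_zeroD[OF acyclic[OF less_imp_neq[OF i]] this]
    have "coboundaries X i s +>\<^bsub>obj (cobj X i) s\<^esub> x = coboundaries X i s"
      by (simp add: cohomology_simps)
    then show "x \<in> coboundaries X i s"
      using X.a_coset_join1 coboundaries_subgroup[OF X] x by blast
  next
    show "carrier (obj M s) \<subseteq> augmentation X \<alpha> s ` carrier (obj (cobj X 0) s)" for s
      using pers_iso_surj[OF iso, of s] by (auto simp: carrier augmentation_def image_image)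
  next
    fix s x assume x: "x \<in> carrier (obj (cobj X 0) s)"
    \<comment> \<open>Writing zero as the value at zero lets injectivity of \<open>\<alpha>\<close>
      turn the question into equality of two cosets.\<close>
    have "augmentation X \<alpha> s x = \<zero>\<^bsub>obj M s\<^esub> \<longleftrightarrow>
        augmentation X \<alpha> s x = augmentation X \<alpha> s \<zero>\<^bsub>obj (cobj X 0) s\<^esub>"
      using pers_hom_zero[OF Xm M aug] by simp
    also have "\<dots> \<longleftrightarrow> ?q s x = ?q s \<zero>\<^bsub>obj (cobj X 0) s\<^esub>"
      unfolding augmentation_def
      by (intro inj_on_eq_iff[OF pers_iso_inj_on[OF iso]]) (auto simp: carrier x)
    also have "\<dots> \<longleftrightarrow> x \<in> coboundaries X 0 s"
      using X.a_coset_join1[OF _ x coboundaries_subgroup[OF X]]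
        X.a_coset_join2[OF x coboundaries_subgroup[OF X]] B.a_subset
      by auto
    finally show "augmentation X \<alpha> s x = \<zero>\<^bsub>obj M s\<^esub> \<longleftrightarrow> x \<in> coboundaries X 0 s" .
  qed
qed

text \<open>The candidates of the choice operator are the covering maps, of which one exists by the
  comparison theorem, and the class of any of them is the whole set.\<close>

lemma lift_class_eq_covering:
  assumes X: "augmented_resolution K M X (augmentation X \<alpha>)"
    and Y: "augmented_resolution K N Y (augmentation Y \<beta>)" and f: "pers_hom K M N f"
  shows "lift_class K X \<alpha> Y \<beta> f = covering K X (augmentation X \<alpha>) Y (augmentation Y \<beta>) f"
proof -
  let ?C = "covering K X (augmentation X \<alpha>) Y (augmentation Y \<beta>) f"
  have "chain_map K X Y \<phi> \<and> lifts X \<alpha> Y \<beta> f \<phi> \<longleftrightarrow> \<phi> \<in> ?C" for \<phi>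
    using lifts_iff_covering[OF augmented_resolution.complex[OF X]
        augmented_resolution.complex[OF Y] augmented_resolution.above[OF X]]
    by (auto simp: covering_def)
  moreover have "(SOME \<phi>. \<phi> \<in> ?C) \<in> ?C"
    using covering_nonempty[OF X Y f] by (simp add: some_in_eq)
  ultimately have "(SOME \<phi>. chain_map K X Y \<phi> \<and> lifts X \<alpha> Y \<beta> f \<phi>) \<in> ?C"
    by simp
  then show ?thesis
    unfolding lift_class_def by (rule hclass_covering[OF X Y])
qed

section \<open>The resolution functor and H^0 in terms of coverings\<close>

lemma resolution_functor_augmented:
  assumes "resolution_functor K P \<alpha>" "persistence_module K M"
  shows "augmented_resolution K M (P M) (augmentation (P M) (\<alpha> M))"
  using assms by (intro augmented_resolution_augmentation) (auto simp: resolution_functor_def)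

text \<open>The identification of \<open>P(N[\<epsilon>])\<close> with
  \<open>P(N)[\<epsilon>]\<close> covers the identity, so composing with it leaves the covered
  morphism unchanged.\<close>

lemma res_mor_shift_eq_covering:
  assumes P: "resolution_functor K P \<alpha>" and M: "persistence_module K M" and N: "persistence_module K N"
    and f: "pers_hom K M (pshift \<epsilon> N) f"
  shows "res_mor_shift K P \<alpha> \<epsilon> M N f = covering K (P M) (augmentation (P M) (\<alpha> M))
    (cshift \<epsilon> (P N)) (mor_shift \<epsilon> (augmentation (P N) (\<alpha> N))) f"
proof -
  note PM = resolution_functor_augmented[OF P M]
    and PN = augmented_resolution_cshift[OF resolution_functor_augmented[OF P N], of \<epsilon>]
    and PN' = resolution_functor_augmented[OF P persistence_module_pshift[OF N], of \<epsilon>]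
  show ?thesis
    unfolding res_mor_shift_def res_shift_ident_def res_mor_def
    using lift_class_eq_covering[OF PM PN' f]
      lift_class_eq_covering[OF PN' PN[folded augmentation_cshift] pers_hom_id]
      K_comp_covering[OF PM PN' PN f pers_hom_id]
    by (simp add: augmentation_cshift pers_comp_def pers_id_def comp_def)
qed

text \<open>A representative of \<open>F\<close> covers the map that it induces on H^0, and
  \<open>F\<close> is the class of that representative; so H^0 inverts the passage from a morphism
  to its covering set.\<close>

lemma K_hom_eq_covering_H0:
  assumes P: "resolution_functor K P \<alpha>" and M: "persistence_module K M" and N: "persistence_module K N"
    and F: "F \<in> K_hom K (P M) (cshift \<epsilon> (P N))"
  shows "F = covering K (P M) (augmentation (P M) (\<alpha> M)) (cshift \<epsilon> (P N))
      (mor_shift \<epsilon> (augmentation (P N) (\<alpha> N))) (H0_mor_shift P \<alpha> \<epsilon> M N F)" (is "_ = ?C")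
    and "pers_hom K M (pshift \<epsilon> N) (H0_mor_shift P \<alpha> \<epsilon> M N F)"
proof -
  let ?X = "P M" and ?Y = "cshift \<epsilon> (P N)"
  note PM = resolution_functor_augmented[OF P M]
    and PN = augmented_resolution_cshift[OF resolution_functor_augmented[OF P N], of \<epsilon>]
  interpret X: augmented_resolution K M ?X "augmentation ?X (\<alpha> M)" by (rule PM)
  interpret Y: augmented_resolution K "pshift \<epsilon> N" ?Y "mor_shift \<epsilon> (augmentation (P N) (\<alpha> N))"
    by (rule PN)
  have iso: "pers_iso K (cohomology ?X 0) M (\<alpha> M)"
    using P M by (simp add: resolution_functor_def projective_resolution_def)
  obtain \<phi> where \<phi>: "chain_map K ?X ?Y \<phi>" and F_eq: "F = hclass K ?X ?Y \<phi>"
    using F by (auto simp: K_hom_def hclass_def elim: quotientE)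
  \<comment> \<open>Reflexivity of homotopy comes from the comparison theorem applied to two equal
    maps.\<close>
  have "\<phi> \<in> F"
    using \<phi> chain_homotopic_if_aug_eq[OF PM PN \<phi> \<phi>] by (simp add: F_eq hclass_def homotopy_rel_def)
  \<comment> \<open>The representative used by \<open>H0_mor_shift\<close> may differ from
    \<open>\<phi>\<close>; being homotopic, the two agree in degree 0 after the
    augmentation.\<close>
  define \<psi> where "\<psi> = (SOME \<phi>. \<phi> \<in> F)"
  have "\<psi> \<in> F"
    using \<open>\<phi> \<in> F\<close> by (auto simp: \<psi>_def some_in_eq)
  then have \<psi>: "chain_map K ?X ?Y \<psi>" and hom: "chain_homotopic K ?X ?Y \<phi> \<psi>"
    by (simp_all add: F_eq hclass_def homotopy_rel_def)
  have "H0_mor_shift P \<alpha> \<epsilon> M N F s (augmentation ?X (\<alpha> M) s x) =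
      mor_shift \<epsilon> (augmentation (P N) (\<alpha> N)) s (\<psi> 0 s x)"
    if x: "x \<in> carrier (obj (cobj ?X 0) s)" for s x
  proof -
    \<comment> \<open>Membership in the carrier of H^0 is what lets \<open>inv_into\<close> recover
      the coset of \<open>x\<close> from its image under the injective
      \<open>\<alpha> M s\<close>.\<close>
    have "coboundaries ?X 0 s +>\<^bsub>obj (cobj ?X 0) s\<^esub> x \<in> carrier (obj (cohomology ?X 0) s)"
      using cocycles_0[OF X.complex X.above] x by (simp add: cohomology_carrier)
    then show ?thesis
      using coset_map_chain_map[OF X.complex Y.complex \<psi> x] pers_iso_inj_on[OF iso]
      by (simp add: H0_mor_shift_def pers_comp_def augmentation_def \<psi>_def[symmetric]
          mor_shift_def coboundaries_cshift)
  qed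
  then have C: "\<phi> \<in> ?C"
    using \<phi> aug_eq_if_chain_homotopic[OF PM PN \<phi> \<psi> hom] by (simp add: covering_def)
  show "F = ?C"
    by (rule trans[OF F_eq hclass_covering[OF PM PN C]])
  show "pers_hom K M (pshift \<epsilon> N) (H0_mor_shift P \<alpha> \<epsilon> M N F)"
    by (rule pers_hom_if_covering[OF PM PN C])
qed

text \<open>The left composite is the covering set of \<open>g[\<epsilon>]\<close> after
  \<open>f\<close>, and the smoothing class is that of the smoothing of \<open>M\<close>; two such
  sets coincide exactly when the covered morphisms do.\<close>

lemma K_comp_K_shift_covering:
  assumes X: "augmented_resolution K M X a" and Y: "augmented_resolution K N Y b"
    and f: "pers_hom K M (pshift \<epsilon> N) f" and g: "pers_hom K N (pshift \<epsilon> M) g" and "\<epsilon> \<ge> 0"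
  shows "K_comp K X (cshift \<epsilon> (cshift \<epsilon> X))
      (K_shift K \<epsilon> Y (cshift \<epsilon> X) (covering K Y b (cshift \<epsilon> X) (mor_shift \<epsilon> a) g))
      (covering K X a (cshift \<epsilon> Y) (mor_shift \<epsilon> b) f) = K_smoothing K (2 * \<epsilon>) X \<longleftrightarrow>
    pers_eq M (pers_comp (mor_shift \<epsilon> g) f) (smoothing (2 * \<epsilon>) M)"
proof -
  note X1 = augmented_resolution_cshift[OF X, of \<epsilon>] and Y1 = augmented_resolution_cshift[OF Y, of \<epsilon>]
  note X2 = augmented_resolution_cshift[OF X1, of \<epsilon>]
  note gf = pers_hom_comp[OF f pers_hom_mor_shift[OF g]]
  \<comment> \<open>Identifies the double shift with the shift by \<open>2 * \<epsilon>\<close>, so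
    that both covering sets concern the same complexes and augmentations.\<close>
  have two: "cshift (2 * \<epsilon>) X = cshift \<epsilon> (cshift \<epsilon> X)" "mor_shift (2 * \<epsilon>) a = mor_shift \<epsilon> (mor_shift \<epsilon> a)"
    by (simp_all add: cshift_cshift mor_shift_mor_shift)
  have "K_smoothing K (2 * \<epsilon>) X =
      covering K X a (cshift \<epsilon> (cshift \<epsilon> X)) (mor_shift \<epsilon> (mor_shift \<epsilon> a)) (smoothing (2 * \<epsilon>) M)"
    using K_smoothing_covering[OF X, of "2 * \<epsilon>"] \<open>\<epsilon> \<ge> 0\<close> by (simp add: two)
  then show ?thesis
    using K_shift_covering[OF Y X1 g] K_comp_covering[OF X Y1 X2 f pers_hom_mor_shift[OF g]]
      pers_eq_if_covering_eq[OF X X2 gf] covering_cong[OF augmented_resolution.aug_hom[OF X]]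
    by metis
qed

text \<open>The two interleaving equations are the same equivalence, used once as it stands and once
  with the roles of \<open>M\<close> and \<open>N\<close> exchanged.\<close>

lemma K_interleaved_covering:
  assumes "augmented_resolution K M X a" "augmented_resolution K N Y b"
    and "pers_hom K M (pshift \<epsilon> N) f" "pers_hom K N (pshift \<epsilon> M) g" "\<epsilon> \<ge> 0"
  shows "K_interleaved K \<epsilon> X Y (covering K X a (cshift \<epsilon> Y) (mor_shift \<epsilon> b) f)
      (covering K Y b (cshift \<epsilon> X) (mor_shift \<epsilon> a) g) \<longleftrightarrow> pers_interleaved K \<epsilon> M N f g"
  using K_comp_K_shift_covering[OF assms] K_comp_K_shift_covering[OF assms(2,1,4,3,5)] assms(3,4)
    covering_in_K_hom[OF assms(1) augmented_resolution_cshift[OF assms(2)] assms(3)]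
    covering_in_K_hom[OF assms(2) augmented_resolution_cshift[OF assms(1)] assms(4)]
  unfolding K_interleaved_def pers_interleaved_def by simp

theorem theorem5p13:
  fixes K :: "'k ring"
    and P :: "('n::finite, 'k, 'v) pmod \<Rightarrow> ('n, 'k, 'v) pcomplex"
    and \<alpha> :: "('n, 'k, 'v) pmod \<Rightarrow> ('n, 'v set, 'v) pmor"
    and M N :: "('n, 'k, 'v) pmod"
    and \<epsilon> :: real
  assumes "Ring.field K"
    and "resolution_functor K P \<alpha>"
    and "persistence_module K M"
    and "persistence_module K N"
    and "\<epsilon> \<ge> 0"
  shows "(\<forall>f g. pers_interleaved K \<epsilon> M N f g \<longrightarrow>
            K_interleaved K \<epsilon> (P M) (P N)
              (res_mor_shift K P \<alpha> \<epsilon> M N f) (res_mor_shift K P \<alpha> \<epsilon> N M g)) \<and>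
         (\<forall>\<phi> \<psi>. K_interleaved K \<epsilon> (P M) (P N) \<phi> \<psi> \<longrightarrow>
            pers_interleaved K \<epsilon> M N
              (H0_mor_shift P \<alpha> \<epsilon> M N \<phi>) (H0_mor_shift P \<alpha> \<epsilon> N M \<psi>))"
proof (intro conjI allI impI)
  note P = assms(2) and M = assms(3) and N = assms(4)
  \<comment> \<open>One equivalence serves both directions: (a) rewrites the values of
    \<open>P\<close> as covering sets, (b) rewrites the given classes.\<close>
  note interleaved = K_interleaved_covering[OF resolution_functor_augmented[OF P M]
      resolution_functor_augmented[OF P N] _ _ \<open>\<epsilon> \<ge> 0\<close>]
  {
    fix f g assume fg: "pers_interleaved K \<epsilon> M N f g"
    then have "pers_hom K M (pshift \<epsilon> N) f" "pers_hom K N (pshift \<epsilon> M) g"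
      by (simp_all add: pers_interleaved_def)
    then show "K_interleaved K \<epsilon> (P M) (P N)
        (res_mor_shift K P \<alpha> \<epsilon> M N f) (res_mor_shift K P \<alpha> \<epsilon> N M g)"
      using fg interleaved
      by (simp add: res_mor_shift_eq_covering[OF P M N] res_mor_shift_eq_covering[OF P N M])
  next
    fix \<phi> \<psi> assume hyp: "K_interleaved K \<epsilon> (P M) (P N) \<phi> \<psi>"
    then have "\<phi> \<in> K_hom K (P M) (cshift \<epsilon> (P N))" "\<psi> \<in> K_hom K (P N) (cshift \<epsilon> (P M))"
      by (simp_all add: K_interleaved_def)
    \<comment> \<open>Each given class is the covering set of its own H^0, and that H^0 is a
      morphism, so the equivalence applies to these two morphisms.\<close>
    note \<phi> = K_hom_eq_covering_H0[OF P M N this(1)] and \<psi> = K_hom_eq_covering_H0[OF P N M this(2)]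
    show "pers_interleaved K \<epsilon> M N (H0_mor_shift P \<alpha> \<epsilon> M N \<phi>) (H0_mor_shift P \<alpha> \<epsilon> N M \<psi>)"
      using hyp interleaved[OF \<phi>(2) \<psi>(2)] \<phi>(1) \<psi>(1) by simp
  }
qed

end
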